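(* Let $1\le d\le n$ be integers. 1. There exists $\mathcal{S}\subseteq 2^{[n]}$ with $\mathrm{VC\text{-}dim}(\mathcal{S})\le d$ and $R^{\rightarrow}(\mathrm{Disj}_n|_{\mathcal{S}\times\mathcal{S}})=\Omega\left(d\log\frac{n}{d}\right)$. 2. There exists $\mathcal{S}\subseteq 2^{[n]}$ with $\mathrm{VC\text{-}dim}(\mathcal{S})\le d$ and $R(\mathrm{Disj}_n|_{\mathcal{S}\times\mathcal{S}})=\Omega\left(d\,\frac{\log(n/d)}{\log\log(n/d)}\right)$. 3. There exists $\mathcal{S}\subseteq 2^{[n]}$ with $\mathrm{VC\text{-}dim}(\mathcal{S})\le d$ and $R(\mathrm{Int}_n|_{\mathcal{S}\times\mathcal{S}})=\Omega\left(d\log\frac{n}{d}\right)$.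
   Context: Communication complexity: for a function $f:\Omega_1\times\Omega_2\to\Omega$, Alice receives $x\in\Omega_1$, Bob receives $y\in\Omega_2$, and they exchange bits to compute $f(x,y)$. In the randomized setting Alice and Bob share an infinite public random string and on every input the output must be correct with probability at least $2/3$; $R(f)$ is the minimum worst-case number of bits exchanged by such a protocol (any number of rounds). $R^{\rightarrow}(f)$ is the one-way version: only Alice sends a message to Bob, and Bob computes the output. $[n]=\{1,\dots,n\}$. $\mathrm{Disj}_n:2^{[n]}\times 2^{[n]}\to\{0,1\}$ is $1$ if $x\cap y=\emptyset$ and $0$ otherwise; $\mathrm{Int}_n:2^{[n]}\times 2^{[n]}\to 2^{[n]}$ is $\mathrm{Int}_n(x,y)=x\cap y$. $f|_{\mathcal{S}\times\mathcal{S}}$ is the restriction of $f$ to inputs from $\mathcal{S}\times\mathcal{S}$, where $\mathcal{S}$ is known to both players. VC dimension: for $y\subseteq[n]$ let $\mathcal{S}|_y=\{y\cap x: x\in\mathcal{S}\}$; $y$ is shattered by $\mathcal{S}$ if $\mathcal{S}|_y=2^y$; $\mathrm{VC\text{-}dim}(\mathcal{S})$ is the size of the largest subset of $[n]$ shattered by $\mathcal{S}$. Asymptotic notation: the constants implied in $\Omega$ are absolute (independent of $n$ and $d$), and the bounds are asserted whenever $n/d$ is at least some absolute constant.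
   Formalization: Parts 1 and 2 are stated for 2 ≤ d ≤ n instead of 1 ≤ d ≤ n, because for d = 1 they are false: every family of VC dimension at most 1 has disjointness complexity bounded by a constant (at most 6 bits one-way) for all n. *)

theory Defs
  imports "HOL-Probability.Probability"
begin

section \<open>Communication protocols\<close>

text \<open>
  A protocol tree over Alice's inputs \<^typ>\<open>'a\<close>, Bob's inputs \<^typ>\<open>'b\<close> and outputs \<^typ>\<open>'c\<close>. An inner
  node says who sends the next bit and how it depends on the sender's input; a bit \<^const>\<open>True\<close> leads to
  the first subtree. When the exchange has ended, Bob computes the output from the transcript
  (that is, from the leaf that was reached) and from his own input. This is the least demanding
  convention with a designated output: a protocol in which both players learn the value, or in
  which the transcript alone determines it, yields a protocol of this kind of the same cost.
\<close>

datatype ('a, 'b, 'c) protocol =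
    Output "'b \<Rightarrow> 'c"
  | Alice_Bit "'a \<Rightarrow> bool" "('a, 'b, 'c) protocol" "('a, 'b, 'c) protocol"
  | Bob_Bit "'b \<Rightarrow> bool" "('a, 'b, 'c) protocol" "('a, 'b, 'c) protocol"

primrec run :: "('a, 'b, 'c) protocol \<Rightarrow> 'a \<Rightarrow> 'b \<Rightarrow> 'c" where
  "run (Output g) x y = g y"
| "run (Alice_Bit h p q) x y = (if h x then run p x y else run q x y)"
| "run (Bob_Bit h p q) x y = (if h y then run p x y else run q x y)"

primrec cost :: "('a, 'b, 'c) protocol \<Rightarrow> nat" where
  "cost (Output g) = 0"
| "cost (Alice_Bit h p q) = Suc (max (cost p) (cost q))"
| "cost (Bob_Bit h p q) = Suc (max (cost p) (cost q))"

primrec one_way :: "('a, 'b, 'c) protocol \<Rightarrow> bool" where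
  "one_way (Output g) \<longleftrightarrow> True"
| "one_way (Alice_Bit h p q) \<longleftrightarrow> one_way p \<and> one_way q"
| "one_way (Bob_Bit h p q) \<longleftrightarrow> False"

section \<open>Randomized communication complexity with public coins\<close>

definition coins :: "(nat \<Rightarrow> bool) measure" where
  "coins = (\<Pi>\<^sub>M i\<in>UNIV. measure_pmf (bernoulli_pmf (1 / 2)))"

text \<open>
  A public-coin protocol is a family of protocol trees indexed by the shared random string. It is
  required to be correct only on the inputs in \<^term>\<open>A \<times> B\<close>, so the complexity measures below, taken
  with \<^term>\<open>A\<close> and \<^term>\<open>B\<close>, are those of the restriction of \<^term>\<open>f\<close> to \<^term>\<open>A \<times> B\<close>.
\<close>

definition computes ::
  "((nat \<Rightarrow> bool) \<Rightarrow> ('a, 'b, 'c) protocol) \<Rightarrow> 'a set \<Rightarrow> 'b set \<Rightarrow> ('a \<Rightarrow> 'b \<Rightarrow> 'c) \<Rightarrow> bool" where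
  "computes P A B f \<longleftrightarrow>
     (\<forall>x\<in>A. \<forall>y\<in>B. {r \<in> space coins. run (P r) x y = f x y} \<in> sets coins \<and>
        measure coins {r \<in> space coins. run (P r) x y = f x y} \<ge> 2 / 3)"

definition R_comm :: "'a set \<Rightarrow> 'b set \<Rightarrow> ('a \<Rightarrow> 'b \<Rightarrow> 'c) \<Rightarrow> nat" where
  "R_comm A B f = (LEAST k. \<exists>P. computes P A B f \<and> (\<forall>r. cost (P r) \<le> k))"

definition R_one_way :: "'a set \<Rightarrow> 'b set \<Rightarrow> ('a \<Rightarrow> 'b \<Rightarrow> 'c) \<Rightarrow> nat" where
  "R_one_way A B f =
     (LEAST k. \<exists>P. computes P A B f \<and> (\<forall>r. one_way (P r) \<and> cost (P r) \<le> k))"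

text \<open>
  For finite sets of inputs such protocols exist, since Alice can send an encoding of her input,
  so the minima above are attained:
\<close>

lemma exists_one_way_protocol:
  assumes "finite A"
  shows "\<exists>p :: ('a, 'b, 'c) protocol. one_way p \<and> (\<forall>x\<in>A. \<forall>y. run p x y = f x y)"
  using assms
proof (induction A rule: finite_induct)
  case empty
  show ?case by (rule exI[of _ "Output undefined"]) simp
next
  case (insert a A)
  then obtain p where "one_way p" "\<forall>x\<in>A. \<forall>y. run p x y = f x y" by blast
  then show ?case
    by (intro exI[of _ "Alice_Bit (\<lambda>x. x = a) (Output (f a)) p"]) auto
qed

lemma prob_space_coins: "prob_space coins"
  unfolding coins_def by (intro prob_space_PiM measure_pmf.prob_space_axioms)

lemma R_one_way_attained:
  assumes "finite A"
  shows "\<exists>P. computes P A B f \<and> (\<forall>r. one_way (P r) \<and> cost (P r) \<le> R_one_way A B f)"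
proof -
  obtain p where p: "one_way p" "\<forall>x\<in>A. \<forall>y. run p x y = f x y"
    using exists_one_way_protocol[OF assms] by blast
  have "computes (\<lambda>_. p) A B f"
    using p(2) by (auto simp: computes_def prob_space.prob_space[OF prob_space_coins])
  with p(1) have "\<exists>P. computes P A B f \<and> (\<forall>r. one_way (P r) \<and> cost (P r) \<le> cost p)"
    by (intro exI[of _ "\<lambda>_. p"]) simp
  then show ?thesis unfolding R_one_way_def by (rule LeastI)
qed

lemma R_comm_attained:
  assumes "finite A"
  shows "\<exists>P. computes P A B f \<and> (\<forall>r. cost (P r) \<le> R_comm A B f)"
proof -
  have "\<exists>P. computes P A B f \<and> (\<forall>r. cost (P r) \<le> R_one_way A B f)"
    using R_one_way_attained[OF assms] by blast
  then show ?thesis unfolding R_comm_def by (rule LeastI)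
qed

section \<open>VC dimension\<close>

definition shattered :: "'a set \<Rightarrow> 'a set set \<Rightarrow> bool" where
  "shattered y S \<longleftrightarrow> (\<lambda>x. y \<inter> x) ` S = Pow y"

text \<open>
  The VC dimension of a family over the finite ground set \<^term>\<open>X\<close>. As \<^term>\<open>Sup {} = (0 :: nat)\<close>, the
  empty family, which does not even shatter the empty set, is given dimension 0.
\<close>

definition VC_dim :: "'a set \<Rightarrow> 'a set set \<Rightarrow> nat" where
  "VC_dim X S = Sup (card ` {y. y \<subseteq> X \<and> shattered y S})"

section \<open>Disjointness and intersection\<close>

text \<open>
  If \<^term>\<open>VC_dim {1..n} S \<le> 1\<close>, then \<^term>\<open>R_one_way S S Disj \<le> 6\<close> for every \<^term>\<open>n\<close>. Indeed, fix
  \<^term>\<open>f \<in> S\<close>: the differences of the members of \<^term>\<open>S\<close> from \<^term>\<open>f\<close> are then initial chains of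
  a forest order, so whether \<^term>\<open>x - f\<close> meets \<^term>\<open>y - f\<close> is an equality test between a label of
  \<^term>\<open>x\<close> and one of \<^term>\<open>y\<close>, and whether \<^term>\<open>f \<inter> x\<close> meets \<^term>\<open>f \<inter> y\<close> depends on one of
  four types of \<^term>\<open>x\<close> and \<^term>\<open>y\<close>. So lower bounds for disjointness that grow with \<^term>\<open>n\<close> can only
  hold for families of VC dimension at least 2; for intersection there is no such exception.
\<close>

definition Disj :: "nat set \<Rightarrow> nat set \<Rightarrow> bool" where
  "Disj x y \<longleftrightarrow> x \<inter> y = {}"

definition Inter_fun :: "nat set \<Rightarrow> nat set \<Rightarrow> nat set" where
  "Inter_fun x y = x \<inter> y"

end

theory Submission
  imports Defs
begin

text \<open>
  For intersection, let Bob hold the full set: he then has to output Alice's set, so the number of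
  leaves of a protocol is at least a constant fraction of the size of the family, and products of
  \<open>d\<close> chains of length \<open>n / d\<close> are a large family of VC dimension \<open>d\<close>.

  For disjointness, any two-party function \<open>f\<close> on inputs of \<open>l\<close> bits can be embedded in a ground set
  of at most \<open>4 ^ l\<close> points, the ones of its communication matrix: Alice's set is a row, Bob's a column, and they
  meet if and only if \<open>f\<close> is 1. Rows are pairwise disjoint and so are columns, so that rows and columns
  together shatter no three points. With \<open>d div 2\<close> disjoint copies for \<open>f\<close> = intersection on
  \<open>l\<close> bits, where \<open>l\<close> is about half the logarithm of \<open>n / d\<close>, the restricted disjointness
  problem contains the full one on \<open>l * (d div 2)\<close> points. So the linear lower bound for the latter
  gives a bound of order \<open>d log (n / d)\<close> even for two-way protocols.

  The linear bound is proved as by Bar-Yossef, Jayram, Kumar and Sivakumar, but by counting. Each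
  coordinate is assigned to one player, who alone may hold it, so that all these inputs are disjoint and the
  free bits are uniform. As there are few leaves, the leaf depends on an average free bit only
  a little, in Hellinger distance. Since leaves are rectangles, it can then hardly tell the pair of
  bits \<open>(0, 0)\<close> from \<open>(1, 1)\<close> at an average coordinate, although the answer changes.
\<close>

section \<open>Biases of subsets of the cube\<close>

text \<open>On \<open>[0, 1]\<close> the exponential is at most \<open>1 + t + t^2\<close>, with the
  analogous bound at \<open>- t\<close>; averaging removes the linear term. This bounds each factor
  of the exponential moment below.\<close>

lemma cosh_le_exp_square:
  fixes x :: real
  assumes "\<bar>x\<bar> \<le> 1"
  shows "cosh x \<le> exp (x\<^sup>2)"
proof -
  have pos: "cosh t \<le> exp (t\<^sup>2)" if t: "0 \<le> t" "t \<le> 1" for t :: real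
  proof -
    have 1: "exp t \<le> 1 + t + t\<^sup>2" by (rule exp_bound) (use t in auto)
    have "1 \<le> (1 - t + t\<^sup>2) * (1 + t)"
      using t by (simp add: algebra_simps power2_eq_square)
    also have "\<dots> \<le> (1 - t + t\<^sup>2) * exp t"
      using t zero_le_power2[of t] by (intro mult_left_mono) (simp, linarith)
    finally have 2: "exp (- t) \<le> 1 - t + t\<^sup>2"
      by (simp add: exp_minus field_simps)
    have "cosh t \<le> 1 + t\<^sup>2" using 1 2 by (simp add: cosh_field_def)
    also have "\<dots> \<le> exp (t\<^sup>2)" by simp
    finally show ?thesis .
  qed
  show ?thesis
    using pos[of x] pos[of "-x"] assms by (cases "x \<ge> 0") auto
qed

text \<open>The exponential-moment proof: compare the average over \<^term>\<open>E\<close> of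
  \<open>exp (\<Sum>i. a i * s i / 2)\<close>, where \<open>a\<close> is the vector of biases, with the sum over the cube.\<close>

lemma level_one_inequality:
  fixes I :: "'i set"
  assumes I: "finite I" and E: "E \<subseteq> Pow I" "E \<noteq> {}"
  shows "(\<Sum>i\<in>I. (real (card {Z\<in>E. i \<in> Z}) - real (card {Z\<in>E. i \<notin> Z}))\<^sup>2 / (real (card E))\<^sup>2)
           \<le> 4 * ln (2 ^ card I / real (card E))"
proof -
  have fE: "finite E" using I E by (meson finite_Pow_iff finite_subset)
  define e where "e = real (card E)"
  have e: "e > 0" using fE E by (simp add: e_def card_gt_0_iff)
  define s :: "'i \<Rightarrow> 'i set \<Rightarrow> real" where "s i Z = (if i \<in> Z then 1 else -1)" for i Z
  define a where "a i = (\<Sum>Z\<in>E. s i Z) / e" for i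
  have a_eq: "a i = (real (card {Z\<in>E. i \<in> Z}) - real (card {Z\<in>E. i \<notin> Z})) / e" for i
  proof -
    have "(\<Sum>Z\<in>E. s i Z) = (\<Sum>Z\<in>{Z\<in>E. i \<in> Z}. 1) + (\<Sum>Z\<in>{Z\<in>E. i \<notin> Z}. -1)"
    proof -
      have "E \<inter> {Z. i \<in> Z} = {Z\<in>E. i \<in> Z}" "E \<inter> - {Z. i \<in> Z} = {Z\<in>E. i \<notin> Z}" by auto
      then show ?thesis using fE by (simp add: s_def sum.If_cases)
    qed
    then show ?thesis by (simp add: a_def)
  qed
  have a_le: "\<bar>a i\<bar> \<le> 1" for i
  proof -
    have "\<bar>\<Sum>Z\<in>E. s i Z\<bar> \<le> (\<Sum>Z\<in>E. \<bar>s i Z\<bar>)" by (rule sum_abs)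
    also have "\<dots> = (\<Sum>Z\<in>E. 1)" by (rule sum.cong) (auto simp: s_def)
    also have "\<dots> = e" by (simp add: e_def)
    finally show ?thesis using e by (simp add: a_def divide_le_eq)
  qed
  define S where "S = (\<Sum>i\<in>I. (a i)\<^sup>2)"
  \<comment> \<open>Jensen will give the exponent \<open>S / 2\<close>, the bound on the factors
    over the cube only \<open>S / 4\<close>. The weight \<open>1 / 2\<close> maximises this gain,
    which is \<open>w * S - w^2 * S\<close> for weight \<open>w\<close>.\<close>
  define h where "h Z = (\<Sum>i\<in>I. a i * s i Z / 2)" for Z
  have "S / 2 = (\<Sum>Z\<in>E. (1 / e) *\<^sub>R h Z)"
  proof -
    have "(\<Sum>Z\<in>E. (1 / e) *\<^sub>R h Z) = (\<Sum>i\<in>I. \<Sum>Z\<in>E. a i * s i Z / 2 / e)"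
      using sum.swap[of "\<lambda>i Z. a i * s i Z / 2 / e" E I] by (simp add: h_def sum_divide_distrib)
    also have "\<dots> = (\<Sum>i\<in>I. a i * a i / 2)"
    proof (intro sum.cong refl)
      fix i
      have "(\<Sum>Z\<in>E. a i * s i Z / 2 / e) = a i * ((\<Sum>Z\<in>E. s i Z) / e) / 2"
        by (simp add: sum_divide_distrib sum_distrib_left mult_ac)
      then show "(\<Sum>Z\<in>E. a i * s i Z / 2 / e) = a i * a i / 2"
        by (simp only: a_def[symmetric])
    qed
    finally show ?thesis by (simp add: S_def power2_eq_square sum_divide_distrib)
  qed
  then have "exp (S / 2) = exp (\<Sum>Z\<in>E. (1 / e) *\<^sub>R h Z)" by simp
  also have "\<dots> \<le> (\<Sum>Z\<in>E. 1 / e * exp (h Z))"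
    by (rule convex_on_sum[OF fE E(2) exp_convex]) (use e in \<open>auto simp: e_def\<close>)
  also have "\<dots> = (\<Sum>Z\<in>E. exp (h Z)) / e"
    by (simp add: sum_divide_distrib)
  also have "\<dots> \<le> (\<Sum>Z\<in>Pow I. exp (h Z)) / e"
    using I E e by (intro divide_right_mono sum_mono2) auto
  \<comment> \<open>Over the whole cube the signs are independent, so the sum factors over the
    coordinates.\<close>
  also have "(\<Sum>Z\<in>Pow I. exp (h Z)) = (\<Prod>i\<in>I. exp (a i / 2) + exp (- a i / 2))"
  proof -
    have "exp (h Z) = (\<Prod>i\<in>Z. exp (a i / 2)) * (\<Prod>i\<in>I - Z. exp (- a i / 2))"
      if "Z \<in> Pow I" for Z
    proof -
      have "h Z = (\<Sum>i\<in>Z. a i / 2) + (\<Sum>i\<in>I - Z. - a i / 2)"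
        unfolding h_def using that I
        by (subst sum.subset_diff[of Z I]) (auto simp: s_def add.commute intro!: arg_cong2[where f = "(+)"] sum.cong)
      then show ?thesis using that I
        by (simp only: exp_add) (simp add: exp_sum finite_subset)
    qed
    then show ?thesis unfolding prod_add[OF I] by (intro sum.cong refl)
  qed
  also have "\<dots> \<le> (\<Prod>i\<in>I. 2 * exp ((a i)\<^sup>2 / 4))"
  proof (intro prod_mono conjI)
    fix i
    have "\<bar>a i / 2\<bar> \<le> 1" using a_le[of i] by simp
    from cosh_le_exp_square[OF this]
    show "exp (a i / 2) + exp (- a i / 2) \<le> 2 * exp ((a i)\<^sup>2 / 4)"
      by (simp add: cosh_field_def power_divide)
  qed (simp add: add_nonneg_nonneg)
  also have "\<dots> = 2 ^ card I * exp (S / 4)"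
    using I by (simp add: prod.distrib S_def exp_sum[symmetric] sum_divide_distrib)
  finally have "exp (S / 2) \<le> 2 ^ card I / e * exp (S / 4)"
    using e by (simp add: divide_right_mono)
  moreover have "exp (S / 2) = exp (S / 4) * exp (S / 4)"
    by (simp flip: exp_add)
  ultimately have "exp (S / 4) \<le> 2 ^ card I / e"
    by (metis exp_gt_zero mult_le_cancel_right_pos)
  then have "S / 4 \<le> ln (2 ^ card I / e)"
    using e by (subst ln_ge_iff) auto
  then show ?thesis
    by (simp add: S_def a_eq power_divide e_def)
qed

text \<open>The level-one inequality is applied to each label class and weighted by the size of the
  class. The weighted logarithms add up to \<open>2 ^ card I\<close> times the entropy of the label,
  which is at most \<open>ln (card \<Lambda>)\<close>.\<close>

lemma sum_label_biases_le:
  fixes I :: "'i set" and lab :: "'i set \<Rightarrow> 'l"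
  assumes I: "finite I" and \<Lambda>: "finite \<Lambda>" "lab ` Pow I \<subseteq> \<Lambda>"
  defines "n1 \<equiv> \<lambda>i l. real (card {Z\<in>Pow I. lab Z = l \<and> i \<in> Z})"
    and "n0 \<equiv> \<lambda>i l. real (card {Z\<in>Pow I. lab Z = l \<and> i \<notin> Z})"
  shows "(\<Sum>i\<in>I. \<Sum>l\<in>\<Lambda>. (n1 i l - n0 i l)\<^sup>2 / (n1 i l + n0 i l)) \<le> 2 ^ card I * (4 * ln (card \<Lambda>))"
proof -
  define E where "E l = {Z\<in>Pow I. lab Z = l}" for l
  define e where "e l = real (card (E l))" for l
  define M where "M = real (card \<Lambda>)"
  have fE: "finite (E l)" for l using I by (simp add: E_def)
  have M: "M > 0" using \<Lambda> by (auto simp: M_def card_gt_0_iff)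
  have n: "n1 i l + n0 i l = e l" for i l
  proof -
    have "card (E l) = card {Z\<in>Pow I. lab Z = l \<and> i \<in> Z} + card {Z\<in>Pow I. lab Z = l \<and> i \<notin> Z}"
      using I by (subst card_Un_disjoint[symmetric]) (auto simp: E_def intro!: arg_cong[where f = card])
    then show ?thesis by (simp add: e_def n1_def n0_def)
  qed
  \<comment> \<open>\<open>ln x \<le> x - 1\<close> compares the class sizes with the uniform size
    \<open>2 ^ card I / M\<close>; the resulting differences cancel in the sum over all
    labels.\<close>
  have l: "(\<Sum>i\<in>I. (n1 i l - n0 i l)\<^sup>2 / e l) \<le> 4 * (e l * ln M + (2 ^ card I / M - e l))" for l
  proof (cases "E l = {}")
    case True
    then have "e l = 0" by (simp add: e_def)
    then show ?thesis using M by simp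
  next
    case False
    then have e: "e l > 0" using fE by (simp add: e_def card_gt_0_iff)
    have level: "(\<Sum>i\<in>I. (n1 i l - n0 i l)\<^sup>2 / (e l)\<^sup>2) \<le> 4 * ln (2 ^ card I / e l)"
      using level_one_inequality[OF I _ False]
      by (auto simp: n1_def n0_def e_def E_def conj_assoc)
    have ln: "e l * ln (2 ^ card I / e l) \<le> e l * ln M + (2 ^ card I / M - e l)"
    proof -
      have "ln (2 ^ card I / e l) = ln M + ln (2 ^ card I / (M * e l))"
        using e M by (simp add: ln_div ln_mult)
      also have "\<dots> \<le> ln M + (2 ^ card I / (M * e l) - 1)"
        using e M by (intro add_left_mono ln_le_minus_one) auto
      finally have "e l * ln (2 ^ card I / e l) \<le> e l * (ln M + (2 ^ card I / (M * e l) - 1))"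
        using e by (intro mult_left_mono) auto
      then show ?thesis using e M by (simp add: algebra_simps)
    qed
    have "(\<Sum>i\<in>I. (n1 i l - n0 i l)\<^sup>2 / e l) = e l * (\<Sum>i\<in>I. (n1 i l - n0 i l)\<^sup>2 / (e l)\<^sup>2)"
      using e by (simp add: sum_distrib_left power2_eq_square)
    also have "\<dots> \<le> e l * (4 * ln (2 ^ card I / e l))"
      using level e by (intro mult_left_mono) auto
    also have "\<dots> = 4 * (e l * ln (2 ^ card I / e l))" by simp
    also have "\<dots> \<le> 4 * (e l * ln M + (2 ^ card I / M - e l))"
      using ln by (intro mult_left_mono) auto
    finally show ?thesis .
  qed
  have tot: "(\<Sum>l\<in>\<Lambda>. e l) = 2 ^ card I"
  proof -
    have "(\<Sum>l\<in>\<Lambda>. card (E l)) = card (\<Union>l\<in>\<Lambda>. E l)"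
      using fE \<Lambda> by (subst card_UN_disjoint) (auto simp: E_def)
    also have "(\<Union>l\<in>\<Lambda>. E l) = Pow I" using \<Lambda> by (auto simp: E_def)
    finally show ?thesis using I by (simp add: e_def card_Pow flip: of_nat_sum)
  qed
  have "(\<Sum>i\<in>I. \<Sum>l\<in>\<Lambda>. (n1 i l - n0 i l)\<^sup>2 / (n1 i l + n0 i l)) = (\<Sum>l\<in>\<Lambda>. \<Sum>i\<in>I. (n1 i l - n0 i l)\<^sup>2 / e l)"
    by (subst sum.swap) (simp add: n)
  also have "\<dots> \<le> (\<Sum>l\<in>\<Lambda>. 4 * (e l * ln M + (2 ^ card I / M - e l)))"
    by (intro sum_mono l)
  also have "\<dots> = 4 * ((\<Sum>l\<in>\<Lambda>. e l) * ln M + (card \<Lambda> * (2 ^ card I / M) - (\<Sum>l\<in>\<Lambda>. e l)))"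
    by (simp only: sum_distrib_left[symmetric] sum.distrib sum_subtractf sum_distrib_right[symmetric] sum_constant)
  also have "\<dots> = 2 ^ card I * (4 * ln M)"
    using M by (simp add: tot) (simp add: M_def)
  finally show ?thesis by (simp add: M_def)
qed

section \<open>Disjointness and rectangular labellings\<close>

text \<open>Cauchy-Schwarz after factoring \<open>p - q\<close> as
  \<open>(sqrt p + sqrt q) * (sqrt p - sqrt q)\<close>: Hellinger distance controls L1 distance,
  here for functions of common total mass \<open>t\<close>.\<close>

lemma hellinger_sum_abs:
  fixes p q :: "'l \<Rightarrow> real"
  assumes "\<And>l. p l \<ge> 0" "\<And>l. q l \<ge> 0" "(\<Sum>l\<in>\<Lambda>. p l) = t" "(\<Sum>l\<in>\<Lambda>. q l) = t"
  shows "(\<Sum>l\<in>\<Lambda>. \<bar>p l - q l\<bar>)\<^sup>2 \<le> 4 * t * (\<Sum>l\<in>\<Lambda>. (sqrt (p l) - sqrt (q l))\<^sup>2)"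
proof -
  have "(\<Sum>l\<in>\<Lambda>. \<bar>p l - q l\<bar>)\<^sup>2 = (\<Sum>l\<in>\<Lambda>. (sqrt (p l) + sqrt (q l)) * \<bar>sqrt (p l) - sqrt (q l)\<bar>)\<^sup>2"
  proof -
    have "\<bar>p l - q l\<bar> = (sqrt (p l) + sqrt (q l)) * \<bar>sqrt (p l) - sqrt (q l)\<bar>" for l
    proof -
      have "p l - q l = (sqrt (p l) + sqrt (q l)) * (sqrt (p l) - sqrt (q l))"
        using assms(1,2)[of l] by (simp add: algebra_simps)
      then show ?thesis using assms(1,2)[of l] by (simp add: abs_mult)
    qed
    then show ?thesis by simp
  qed
  also have "\<dots> \<le> (\<Sum>l\<in>\<Lambda>. (sqrt (p l) + sqrt (q l))\<^sup>2) * (\<Sum>l\<in>\<Lambda>. \<bar>sqrt (p l) - sqrt (q l)\<bar>\<^sup>2)"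
    by (rule Cauchy_Schwarz_ineq_sum)
  also have "\<dots> \<le> (\<Sum>l\<in>\<Lambda>. 2 * p l + 2 * q l) * (\<Sum>l\<in>\<Lambda>. (sqrt (p l) - sqrt (q l))\<^sup>2)"
  proof -
    have "(sqrt (p l) + sqrt (q l))\<^sup>2 \<le> 2 * p l + 2 * q l" for l
    proof -
      have "0 \<le> (sqrt (p l) - sqrt (q l))\<^sup>2" by simp
      then show ?thesis using assms(1,2)[of l] by (simp add: power2_diff power2_sum)
    qed
    then show ?thesis by (auto intro!: mult_mono sum_mono sum_nonneg add_nonneg_nonneg assms)
  qed
  also have "(\<Sum>l\<in>\<Lambda>. 2 * p l + 2 * q l) = 4 * t"
    by (simp add: sum.distrib sum_distrib_left[symmetric] assms)
  finally show ?thesis .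
qed

text \<open>Holds since \<open>p + q \<le> (sqrt p + sqrt q)^2\<close>. It turns the bias terms of
  \<open>sum_label_biases_le\<close> into bounds on Hellinger distances.\<close>

lemma sqrt_diff_square_le:
  fixes p q :: real
  assumes "p \<ge> 0" "q \<ge> 0"
  shows "(sqrt p - sqrt q)\<^sup>2 \<le> (p - q)\<^sup>2 / (p + q)"
proof (cases "p + q = 0")
  case True
  then have "p = 0" "q = 0" using assms by auto
  then show ?thesis by simp
next
  case False
  have "p + q \<le> (sqrt p + sqrt q)\<^sup>2" using assms by (simp add: power2_sum)
  then have "(sqrt p - sqrt q)\<^sup>2 * (p + q) \<le> (sqrt p - sqrt q)\<^sup>2 * (sqrt p + sqrt q)\<^sup>2"
    by (intro mult_left_mono) auto
  also have "\<dots> = (p - q)\<^sup>2"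
    using assms by (simp add: power_mult_distrib[symmetric] algebra_simps)
  finally show ?thesis using False assms by (simp add: field_simps)
qed

text \<open>The cut-and-paste lemma: the rectangle property, in the form of the product hypothesis, makes
  the Hellinger distance of \<^term>\<open>p00\<close> and \<^term>\<open>p11\<close> equal to that of \<^term>\<open>p01\<close> and \<^term>\<open>p10\<close>.\<close>

lemma cut_and_paste:
  fixes p00 p01 p10 p11 :: "'l \<Rightarrow> real"
  assumes nonneg: "\<And>l. p00 l \<ge> 0" "\<And>l. p01 l \<ge> 0" "\<And>l. p10 l \<ge> 0" "\<And>l. p11 l \<ge> 0"
    and tot: "sum p00 \<Lambda> = t" "sum p01 \<Lambda> = t" "sum p10 \<Lambda> = t" "sum p11 \<Lambda> = t"
    and rect: "\<And>l. p00 l * p11 l = p01 l * p10 l"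
  shows "(\<Sum>l\<in>\<Lambda>. \<bar>p00 l - p11 l\<bar>)\<^sup>2 \<le>
           8 * t * (\<Sum>l\<in>\<Lambda>. (p10 l - p00 l)\<^sup>2 / (p10 l + p00 l) + (p01 l - p00 l)\<^sup>2 / (p01 l + p00 l))"
proof -
  have t: "t \<ge> 0" using sum_nonneg[of \<Lambda> p00] nonneg tot by auto
  \<comment> \<open>For equal total masses the squared distance depends on \<open>p\<close> and
    \<open>q\<close> only through the products \<open>p l * q l\<close>.\<close>
  have H: "(\<Sum>l\<in>\<Lambda>. (sqrt (p l) - sqrt (q l))\<^sup>2) = 2 * t - 2 * (\<Sum>l\<in>\<Lambda>. sqrt (p l * q l))"
    if "\<And>l. p l \<ge> 0" "\<And>l. q l \<ge> 0" "sum p \<Lambda> = t" "sum q \<Lambda> = t" for p q :: "'l \<Rightarrow> real"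
  proof -
    have "(\<Sum>l\<in>\<Lambda>. (sqrt (p l) - sqrt (q l))\<^sup>2) = (\<Sum>l\<in>\<Lambda>. p l + q l - 2 * sqrt (p l * q l))"
      using that(1,2) by (simp add: power2_diff real_sqrt_mult mult.assoc)
    then show ?thesis using that(3,4) by (simp add: sum_subtractf sum.distrib sum_distrib_left)
  qed
  have "(\<Sum>l\<in>\<Lambda>. \<bar>p00 l - p11 l\<bar>)\<^sup>2 \<le> 4 * t * (\<Sum>l\<in>\<Lambda>. (sqrt (p00 l) - sqrt (p11 l))\<^sup>2)"
    by (rule hellinger_sum_abs) (use nonneg tot in auto)
  also have "(\<Sum>l\<in>\<Lambda>. (sqrt (p00 l) - sqrt (p11 l))\<^sup>2) = (\<Sum>l\<in>\<Lambda>. (sqrt (p10 l) - sqrt (p01 l))\<^sup>2)"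
    using nonneg tot by (simp add: H rect mult.commute)
  also have "\<dots> \<le> (\<Sum>l\<in>\<Lambda>. 2 * ((p10 l - p00 l)\<^sup>2 / (p10 l + p00 l) + (p01 l - p00 l)\<^sup>2 / (p01 l + p00 l)))"
  proof (rule sum_mono)
    fix l
    let ?a = "sqrt (p10 l) - sqrt (p00 l)" and ?b = "sqrt (p01 l) - sqrt (p00 l)"
    \<comment> \<open>Parallelogram identity: going from \<open>p10\<close> to \<open>p01\<close>
      through \<open>p00\<close> costs a factor 2.\<close>
    have "(sqrt (p10 l) - sqrt (p01 l))\<^sup>2 = 2 * (?a\<^sup>2 + ?b\<^sup>2) - (?a + ?b)\<^sup>2"
      by (simp add: power2_eq_square algebra_simps)
    also have "\<dots> \<le> 2 * (?a\<^sup>2 + ?b\<^sup>2)" by simp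
    also have "\<dots> \<le> 2 * ((p10 l - p00 l)\<^sup>2 / (p10 l + p00 l) + (p01 l - p00 l)\<^sup>2 / (p01 l + p00 l))"
      by (intro mult_left_mono add_mono sqrt_diff_square_le nonneg) auto
    finally show "(sqrt (p10 l) - sqrt (p01 l))\<^sup>2 \<le> \<dots>" .
  qed
  also have "\<dots> = 2 * (\<Sum>l\<in>\<Lambda>. (p10 l - p00 l)\<^sup>2 / (p10 l + p00 l) + (p01 l - p00 l)\<^sup>2 / (p01 l + p00 l))"
    by (rule sum_distrib_left[symmetric])
  finally show ?thesis using t by (simp add: mult_left_mono)
qed

text \<open>Every fibre is a combinatorial rectangle: exchanging the two input pairs gives the other
  mixed corner.\<close>

definition rectangular :: "('a \<Rightarrow> 'b \<Rightarrow> 'l) \<Rightarrow> bool" where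
  "rectangular L \<longleftrightarrow> (\<forall>x y x' y'. L x y = L x' y' \<longrightarrow> L x y' = L x y)"

definition put :: "bool \<Rightarrow> 'i \<Rightarrow> 'i set \<Rightarrow> 'i set" where
  "put a i x = (if a then insert i x else x)"

text \<open>For a set \<^term>\<open>\<delta>\<close> of coordinates not containing \<^term>\<open>i\<close>, the inputs counted here are zero
  for Alice off \<^term>\<open>\<delta>\<close> and for Bob on \<^term>\<open>\<delta>\<close>, except that coordinate \<^term>\<open>i\<close> is \<^term>\<open>a\<close>
  for Alice and \<^term>\<open>b\<close> for Bob.\<close>

definition label_count ::
    "('i set \<Rightarrow> 'i set \<Rightarrow> 'l) \<Rightarrow> 'i set \<Rightarrow> 'i \<Rightarrow> 'i set \<Rightarrow> bool \<Rightarrow> bool \<Rightarrow> 'l \<Rightarrow> nat" where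
  "label_count L I i \<delta> a b l =
     card {Z \<in> Pow (I - {i}). L (put a i (Z \<inter> \<delta>)) (put b i (Z - \<delta>)) = l}"

lemma card_split_product:
  assumes "finite J" "\<delta> \<subseteq> J"
  shows "card {Z \<in> Pow J. P (Z \<inter> \<delta>) \<and> Q (Z - \<delta>)} = card {x \<in> Pow \<delta>. P x} * card {y \<in> Pow (J - \<delta>). Q y}"
proof -
  have "bij_betw (\<lambda>Z. (Z \<inter> \<delta>, Z - \<delta>)) {Z \<in> Pow J. P (Z \<inter> \<delta>) \<and> Q (Z - \<delta>)}
          ({x \<in> Pow \<delta>. P x} \<times> {y \<in> Pow (J - \<delta>). Q y})"
  proof (rule bij_betw_byWitness[where f' = "\<lambda>(x, y). x \<union> y"])
    show "(\<lambda>(x, y). x \<union> y) ` ({x \<in> Pow \<delta>. P x} \<times> {y \<in> Pow (J - \<delta>). Q y})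
            \<subseteq> {Z \<in> Pow J. P (Z \<inter> \<delta>) \<and> Q (Z - \<delta>)}"
    proof clarsimp
      fix x y assume "x \<subseteq> \<delta>" "y \<subseteq> J - \<delta>" and PQ: "P x" "Q y"
      then have "(x \<union> y) \<inter> \<delta> = x" "x \<union> y - \<delta> = y" by auto
      then show "x \<subseteq> J \<and> y \<subseteq> J \<and> P ((x \<union> y) \<inter> \<delta>) \<and> Q (x \<union> y - \<delta>)"
        using PQ \<open>x \<subseteq> \<delta>\<close> \<open>y \<subseteq> J - \<delta>\<close> assms by auto
    qed
  qed auto
  then show ?thesis by (simp add: bij_betw_same_card card_cartesian_product)
qed

text \<open>For fixed \<open>\<delta>\<close> the players use disjoint sets of free bits, so each
  count is a factor depending on \<open>a\<close> times a factor depending on \<open>b\<close>. This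
  is the product hypothesis of \<open>cut_and_paste\<close>.\<close>

lemma label_count_rectangle:
  assumes L: "rectangular L" and I: "finite I" and \<delta>: "\<delta> \<subseteq> I - {i}"
  shows "label_count L I i \<delta> False False l * label_count L I i \<delta> True True l =
         label_count L I i \<delta> False True l * label_count L I i \<delta> True False l"
proof -
  define A where "A = {x. \<exists>y. L x y = l}"
  define B where "B = {y. \<exists>x. L x y = l}"
  have "L x y = l \<longleftrightarrow> x \<in> A \<and> y \<in> B" for x y
    using L unfolding rectangular_def A_def B_def by (smt (verit) mem_Collect_eq)
  then have "label_count L I i \<delta> a b l =
      card {x \<in> Pow \<delta>. put a i x \<in> A} * card {y \<in> Pow (I - {i} - \<delta>). put b i y \<in> B}" for a b
    using card_split_product[of "I - {i}" \<delta> "\<lambda>x. put a i x \<in> A" "\<lambda>y. put b i y \<in> B"] I \<delta>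
    by (simp add: label_count_def)
  then show ?thesis by simp
qed

lemma sum_label_count:
  assumes I: "finite I" "i \<in> I" and \<Lambda>: "finite \<Lambda>" "\<And>x y. L x y \<in> \<Lambda>"
  shows "(\<Sum>l\<in>\<Lambda>. label_count L I i \<delta> a b l) = 2 ^ (card I - 1)"
proof -
  have "(\<Sum>l\<in>\<Lambda>. label_count L I i \<delta> a b l) =
      card (\<Union>l\<in>\<Lambda>. {Z \<in> Pow (I - {i}). L (put a i (Z \<inter> \<delta>)) (put b i (Z - \<delta>)) = l})"
    unfolding label_count_def using I \<Lambda> by (subst card_UN_disjoint) auto
  also have "(\<Union>l\<in>\<Lambda>. {Z \<in> Pow (I - {i}). L (put a i (Z \<inter> \<delta>)) (put b i (Z - \<delta>)) = l}) = Pow (I - {i})"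
    using \<Lambda> by auto
  finally show ?thesis using I by (simp add: card_Pow)
qed

lemma sum_Pow_insert_split:
  assumes "finite I" "i \<in> I"
  shows "(\<Sum>\<delta>\<in>Pow I. f \<delta>) = (\<Sum>\<delta>\<in>Pow (I - {i}). f (insert i \<delta>) + f \<delta>)"
proof -
  have "Pow I = insert i ` Pow (I - {i}) \<union> Pow (I - {i})"
    using assms Pow_insert[of i "I - {i}"] by (auto simp: insert_absorb)
  moreover have "insert i ` Pow (I - {i}) \<inter> Pow (I - {i}) = {}" by auto
  moreover have "inj_on (insert i) (Pow (I - {i}))" by (auto simp: inj_on_def)
  ultimately show ?thesis
    using assms by (simp add: sum.union_disjoint sum.reindex sum.distrib add.commute)
qed

text \<open>The entropy bound: the label is one of \<^term>\<open>card \<Lambda>\<close>, so that on average it depends little on a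
  single free coordinate, whichever player holds that coordinate.\<close>

lemma sum_label_count_differences:
  fixes L :: "'i set \<Rightarrow> 'i set \<Rightarrow> 'l"
  assumes I: "finite I" and \<Lambda>: "finite \<Lambda>" "\<And>x y. L x y \<in> \<Lambda>"
  defines "N \<equiv> \<lambda>i \<delta> a b l. real (label_count L I i \<delta> a b l)"
  shows "(\<Sum>i\<in>I. \<Sum>\<delta>\<in>Pow (I - {i}). \<Sum>l\<in>\<Lambda>.
            (N i \<delta> True False l - N i \<delta> False False l)\<^sup>2 / (N i \<delta> True False l + N i \<delta> False False l) +
            (N i \<delta> False True l - N i \<delta> False False l)\<^sup>2 / (N i \<delta> False True l + N i \<delta> False False l))
           \<le> 4 ^ card I * (4 * ln (card \<Lambda>))"
proof -
  define lab where "lab \<delta> Z = L (Z \<inter> \<delta>) (Z - \<delta>)" for \<delta> Z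
  define n1 where "n1 \<delta> i l = real (card {Z\<in>Pow I. lab \<delta> Z = l \<and> i \<in> Z})" for \<delta> i l
  define n0 where "n0 \<delta> i l = real (card {Z\<in>Pow I. lab \<delta> Z = l \<and> i \<notin> Z})" for \<delta> i l
  define G where "G \<delta> i = (\<Sum>l\<in>\<Lambda>. (n1 \<delta> i l - n0 \<delta> i l)\<^sup>2 / (n1 \<delta> i l + n0 \<delta> i l))" for \<delta> i
  \<comment> \<open>Putting \<open>i\<close> into \<open>\<delta>\<close> gives the free bit
    \<open>i\<close> to Alice, leaving it out gives it to Bob; in both cases the value 0 yields the
    pair \<open>(0, 0)\<close>.\<close>
  have n: "n0 \<delta> i l = N i \<delta> False False l" "n0 (insert i \<delta>) i l = N i \<delta> False False l"
    "n1 \<delta> i l = N i \<delta> False True l" "n1 (insert i \<delta>) i l = N i \<delta> True False l"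
    if i: "i \<in> I" "\<delta> \<subseteq> I - {i}" for i \<delta> l
  proof -
    have sets: "Z \<inter> insert i \<delta> = Z \<inter> \<delta>" "Z - insert i \<delta> = Z - \<delta>"
      "insert i Z \<inter> \<delta> = Z \<inter> \<delta>" "insert i Z - \<delta> = insert i (Z - \<delta>)"
      "insert i Z \<inter> insert i \<delta> = insert i (Z \<inter> \<delta>)" "insert i Z - insert i \<delta> = Z - \<delta>"
      if "i \<notin> Z" for Z
      using i that by auto
    have lab: "lab \<delta> Z = L (Z \<inter> \<delta>) (Z - \<delta>)" "lab (insert i \<delta>) Z = L (Z \<inter> \<delta>) (Z - \<delta>)"
      "lab \<delta> (insert i Z) = L (Z \<inter> \<delta>) (insert i (Z - \<delta>))"
      "lab (insert i \<delta>) (insert i Z) = L (insert i (Z \<inter> \<delta>)) (Z - \<delta>)" if "i \<notin> Z" for Z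
      unfolding lab_def sets[OF that] by (rule refl)+
    have Pow: "Z \<in> Pow (I - {i}) \<longleftrightarrow> Z \<in> Pow I \<and> i \<notin> Z" for Z by auto
    have n0_eq: "{Z\<in>Pow I. f Z = l \<and> i \<notin> Z} = {Z \<in> Pow (I - {i}). f Z = l}" for f :: "'i set \<Rightarrow> 'l"
      by auto
    have n1_eq: "card {Z\<in>Pow I. f Z = l \<and> i \<in> Z} = card {Z\<in>Pow (I - {i}). f (insert i Z) = l}"
      for f :: "'i set \<Rightarrow> 'l"
      by (rule bij_betw_same_card[OF bij_betw_byWitness[where f = "\<lambda>Z. Z - {i}" and f' = "insert i"]])
        (use i in \<open>auto simp: insert_absorb\<close>)
    have cong: "card {Z \<in> Pow (I - {i}). f Z = l} = card {Z \<in> Pow (I - {i}). g Z = l}"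
      if "\<And>Z. i \<notin> Z \<Longrightarrow> f Z = g Z" for f g :: "'i set \<Rightarrow> 'l"
      using that unfolding Pow by (metis (mono_tags, lifting))
    show "n0 \<delta> i l = N i \<delta> False False l" "n0 (insert i \<delta>) i l = N i \<delta> False False l"
      "n1 \<delta> i l = N i \<delta> False True l" "n1 (insert i \<delta>) i l = N i \<delta> True False l"
      unfolding n0_def n1_def N_def label_count_def n0_eq n1_eq of_nat_eq_iff
      by (rule cong, simp add: lab put_def)+
  qed
  have "(\<Sum>i\<in>I. G \<delta> i) \<le> 2 ^ card I * (4 * ln (card \<Lambda>))" for \<delta>
    unfolding G_def n1_def n0_def using I \<Lambda> by (intro sum_label_biases_le) (auto simp: lab_def)
  then have "(\<Sum>\<delta>\<in>Pow I. \<Sum>i\<in>I. G \<delta> i) \<le> (\<Sum>\<delta>\<in>Pow I. 2 ^ card I * (4 * ln (card \<Lambda>)))"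
    by (intro sum_mono)
  also have "\<dots> = 4 ^ card I * (4 * ln (card \<Lambda>))"
    using I by (simp add: card_Pow power_mult_distrib[symmetric])
  also have "(\<Sum>\<delta>\<in>Pow I. \<Sum>i\<in>I. G \<delta> i) = (\<Sum>i\<in>I. \<Sum>\<delta>\<in>Pow I. G \<delta> i)"
    by (rule sum.swap)
  also have "\<dots> = (\<Sum>i\<in>I. \<Sum>\<delta>\<in>Pow (I - {i}). G (insert i \<delta>) i + G \<delta> i)"
    using I by (intro sum.cong refl sum_Pow_insert_split)
  also have "\<dots> = (\<Sum>i\<in>I. \<Sum>\<delta>\<in>Pow (I - {i}). \<Sum>l\<in>\<Lambda>.
            (N i \<delta> True False l - N i \<delta> False False l)\<^sup>2 / (N i \<delta> True False l + N i \<delta> False False l) +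
            (N i \<delta> False True l - N i \<delta> False False l)\<^sup>2 / (N i \<delta> False True l + N i \<delta> False False l))"
    unfolding G_def by (intro sum.cong refl) (simp add: n sum.distrib)
  finally show ?thesis .
qed

section \<open>The hard input distribution for disjointness\<close>

text \<open>An index consists of a coordinate \<open>i\<close>, an assignment
  \<open>\<delta>\<close>, free bits \<open>Z\<close> and a bit \<open>c\<close>. Its inputs are
  disjoint if \<open>c\<close> is false and meet exactly in \<open>i\<close> otherwise. Counting
  indices gives each input pair the weight of all indices that produce it.\<close>

definition zero_or_one_common :: "'i set \<Rightarrow> ('i \<times> 'i set \<times> 'i set \<times> bool) set" where
  "zero_or_one_common I = (SIGMA i:I. Pow (I - {i}) \<times> Pow (I - {i}) \<times> UNIV)"

definition alice_input :: "'i \<times> 'i set \<times> 'i set \<times> bool \<Rightarrow> 'i set" where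
  "alice_input = (\<lambda>(i, \<delta>, Z, c). put c i (Z \<inter> \<delta>))"

definition bob_input :: "'i \<times> 'i set \<times> 'i set \<times> bool \<Rightarrow> 'i set" where
  "bob_input = (\<lambda>(i, \<delta>, Z, c). put c i (Z - \<delta>))"

lemma finite_zero_or_one_common: "finite I \<Longrightarrow> finite (zero_or_one_common I)"
  by (auto simp: zero_or_one_common_def)

lemma card_zero_or_one_common:
  assumes "finite I"
  shows "2 * card (zero_or_one_common I) = card I * 4 ^ card I"
proof -
  have "card (zero_or_one_common I) = (\<Sum>i\<in>I. 2 ^ (card I - 1) * (2 ^ (card I - 1) * 2))"
    using assms unfolding zero_or_one_common_def
    by (subst card_SigmaI) (auto simp: card_cartesian_product card_Pow intro!: sum.cong)
  also have "\<dots> = card I * (2 ^ (card I - 1) * (2 ^ (card I - 1) * 2))" by simp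
  finally show ?thesis
    by (cases "card I") (simp_all add: power_mult_distrib[symmetric] flip: power_add mult_2)
qed

lemma inputs_in_Pow:
  assumes "j \<in> zero_or_one_common I"
  shows "alice_input j \<in> Pow I" "bob_input j \<in> Pow I"
  using assms by (auto simp: zero_or_one_common_def alice_input_def bob_input_def put_def split: if_splits)

text \<open>If the output is right on most of these inputs, then it behaves differently on the disjoint and
  the intersecting ones, which \<open>cut_and_paste\<close> and \<open>sum_label_count_differences\<close> forbid when there
  are few labels.\<close>

theorem disjointness_labels_lower_bound:
  fixes L :: "'i set \<Rightarrow> 'i set \<Rightarrow> 'l" and out :: "'l \<Rightarrow> bool"
  assumes I: "finite I" and L: "rectangular L" and \<Lambda>: "finite \<Lambda>" "\<And>x y. L x y \<in> \<Lambda>"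
    and correct: "2 / 3 * real (card (zero_or_one_common I)) \<le>
      real (card {j \<in> zero_or_one_common I.
        out (L (alice_input j) (bob_input j)) \<longleftrightarrow> alice_input j \<inter> bob_input j = {}})"
  shows "real (card I) \<le> 1152 * ln (card \<Lambda>)"
proof (cases "I = {}")
  case True
  have "card \<Lambda> \<ge> 1" using \<Lambda> by (metis card_0_eq empty_iff less_one not_le)
  then show ?thesis using True by simp
next
  case False
  define N where "N i \<delta> a b l = real (label_count L I i \<delta> a b l)" for i \<delta> a b l
  define m where "m = card I"
  have m: "m > 0" using False I by (simp add: m_def card_gt_0_iff)
  define t :: real where "t = 2 ^ (m - 1)"
  define Q where "Q = (SIGMA i:I. Pow (I - {i}))"
  have fQ: "finite Q" using I by (simp add: Q_def)
  have card_Q: "real (card Q) = m * t"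
    using I unfolding Q_def by (subst card_SigmaI) (auto simp: card_Pow m_def t_def)
  have tt: "4 * t * t = 4 ^ m"
    using m by (cases m) (simp_all add: t_def power_mult_distrib[symmetric])
  define G where "G = (\<lambda>(i, \<delta>). \<Sum>l\<in>\<Lambda>.
            (N i \<delta> True False l - N i \<delta> False False l)\<^sup>2 / (N i \<delta> True False l + N i \<delta> False False l) +
            (N i \<delta> False True l - N i \<delta> False False l)\<^sup>2 / (N i \<delta> False True l + N i \<delta> False False l))"
  define W where "W = (\<lambda>(i, \<delta>). \<Sum>l\<in>\<Lambda>. \<bar>N i \<delta> False False l - N i \<delta> True True l\<bar>)"
  have tot: "(\<Sum>l\<in>\<Lambda>. N i \<delta> a b l) = t" if "i \<in> I" for i \<delta> a b
    using sum_label_count[OF I that \<Lambda>] unfolding N_def t_def m_def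
    by (simp flip: of_nat_sum)
  have W_G: "(W q)\<^sup>2 \<le> 8 * t * G q" if qQ: "q \<in> Q" for q
  proof -
    obtain i \<delta> where q: "q = (i, \<delta>)" "i \<in> I" "\<delta> \<subseteq> I - {i}"
      using qQ by (cases q) (auto simp: Q_def)
    have "N i \<delta> False False l * N i \<delta> True True l = N i \<delta> False True l * N i \<delta> True False l" for l
      unfolding N_def of_nat_mult[symmetric] using label_count_rectangle[OF L I q(3)] by simp
    then show ?thesis
      unfolding q W_def G_def prod.case using tot[OF q(2)]
      by (intro cut_and_paste) (auto simp: N_def)
  qed
  \<comment> \<open>Cauchy-Schwarz over \<open>Q\<close> leads to the squared distances, to which
    the cut-and-paste and the entropy bounds apply.\<close>
  have "(\<Sum>q\<in>Q. W q)\<^sup>2 \<le> (\<Sum>q\<in>Q. (W q)\<^sup>2) * card Q"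
    by (rule sum_squared_le_sum_of_squares)
  also have "\<dots> \<le> (\<Sum>q\<in>Q. 8 * t * G q) * card Q"
    by (intro mult_right_mono sum_mono W_G) auto
  also have "\<dots> = 8 * t * (\<Sum>q\<in>Q. G q) * (m * t)"
    by (simp add: sum_distrib_left card_Q)
  also have "\<dots> \<le> 8 * t * (4 ^ m * (4 * ln (card \<Lambda>))) * (m * t)"
  proof -
    have "(\<Sum>q\<in>Q. G q) \<le> 4 ^ m * (4 * ln (card \<Lambda>))"
      using sum_label_count_differences[OF I \<Lambda>] I
      by (simp add: Q_def G_def sum.Sigma[symmetric] N_def m_def)
    then show ?thesis by (intro mult_right_mono mult_left_mono) (auto simp: t_def)
  qed
  also have "\<dots> = 4 ^ m * (8 * m * ln (card \<Lambda>)) * (4 * t * t)" by simp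
  finally have upper: "(\<Sum>q\<in>Q. W q)\<^sup>2 \<le> 4 ^ m * (8 * m * ln (card \<Lambda>)) * 4 ^ m"
    unfolding tt .
  \<comment> \<open>At least \<open>2 / 3\<close> of all \<open>m * 4 ^ m / 2\<close> indices are
    answered correctly; an output ignoring \<open>c\<close> would be right on
    \<open>m * 4 ^ m / 4\<close> of them. The excess must come from the distances
    \<open>W\<close>.\<close>
  have lower: "m * 4 ^ m / 12 \<le> (\<Sum>q\<in>Q. W q)"
  proof -
    define C where "C i \<delta> c = {Z \<in> Pow (I - {i}). out (L (put c i (Z \<inter> \<delta>)) (put c i (Z - \<delta>))) \<longleftrightarrow> \<not> c}" for i \<delta> c
    \<comment> \<open>If the label counts agreed for both values of \<open>c\<close>, the output
      would be right for exactly \<open>t\<close> of the \<open>2 * t\<close> pairs of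
      \<open>Z\<close> and \<open>c\<close>; \<open>W\<close> bounds the gain over this.\<close>
    have C: "real (card (C i \<delta> False)) + real (card (C i \<delta> True)) \<le> t + W (i, \<delta>)" if i: "i \<in> I" for i \<delta>
    proof -
      have "card {Z \<in> Pow (I - {i}). L (put c i (Z \<inter> \<delta>)) (put c i (Z - \<delta>)) \<in> X} =
          (\<Sum>l\<in>X. label_count L I i \<delta> c c l)" if X: "X \<subseteq> \<Lambda>" for X c
      proof -
        have "{Z \<in> Pow (I - {i}). L (put c i (Z \<inter> \<delta>)) (put c i (Z - \<delta>)) \<in> X} =
            (\<Union>l\<in>X. {Z \<in> Pow (I - {i}). L (put c i (Z \<inter> \<delta>)) (put c i (Z - \<delta>)) = l})" by auto
        then show ?thesis
          unfolding label_count_def using I X \<Lambda>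
          by (simp only:) (subst card_UN_disjoint, auto intro: finite_subset)
      qed
      note count = this
      have "real (card (C i \<delta> c)) = (\<Sum>l | l \<in> \<Lambda> \<and> (out l \<longleftrightarrow> \<not> c). N i \<delta> c c l)" for c
      proof -
        have "C i \<delta> c = {Z \<in> Pow (I - {i}). L (put c i (Z \<inter> \<delta>)) (put c i (Z - \<delta>)) \<in> {l\<in>\<Lambda>. out l \<longleftrightarrow> \<not> c}}"
          using \<Lambda> by (auto simp: C_def)
        then show ?thesis by (simp only: count[OF Collect_restrict] N_def of_nat_sum)
      qed
      from this[of False] this[of True]
      have "real (card (C i \<delta> False)) = (\<Sum>l | l \<in> \<Lambda> \<and> out l. N i \<delta> False False l)"
        "real (card (C i \<delta> True)) = (\<Sum>l | l \<in> \<Lambda> \<and> \<not> out l. N i \<delta> True True l)"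
        by simp_all
      moreover have "(\<Sum>l | l \<in> \<Lambda> \<and> out l. N i \<delta> True True l) + (\<Sum>l | l \<in> \<Lambda> \<and> \<not> out l. N i \<delta> True True l) = t"
      proof -
        have "\<Lambda> = {l\<in>\<Lambda>. out l} \<union> {l\<in>\<Lambda>. \<not> out l}" by auto
        then show ?thesis using \<Lambda>(1) tot[OF i, of \<delta> True True]
          by (subst sum.union_disjoint[symmetric]) auto
      qed
      moreover have "(\<Sum>l | l \<in> \<Lambda> \<and> out l. N i \<delta> False False l) - (\<Sum>l | l \<in> \<Lambda> \<and> out l. N i \<delta> True True l)
          \<le> W (i, \<delta>)"
      proof -
        have "(\<Sum>l | l \<in> \<Lambda> \<and> out l. N i \<delta> False False l - N i \<delta> True True l)
            \<le> (\<Sum>l | l \<in> \<Lambda> \<and> out l. \<bar>N i \<delta> False False l - N i \<delta> True True l\<bar>)"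
          by (intro sum_mono) auto
        also have "\<dots> \<le> W (i, \<delta>)"
          unfolding W_def prod.case using \<Lambda> by (intro sum_mono2) auto
        finally show ?thesis by (simp add: sum_subtractf)
      qed
      ultimately show ?thesis by linarith
    qed
    have "card {j \<in> zero_or_one_common I. out (L (alice_input j) (bob_input j)) \<longleftrightarrow> alice_input j \<inter> bob_input j = {}}
        = (\<Sum>(i, \<delta>)\<in>Q. card (C i \<delta> False) + card (C i \<delta> True))"
    proof -
      have "bij_betw (\<lambda>((i, \<delta>), c, Z). (i, \<delta>, Z, c)) (SIGMA (i, \<delta>):Q. SIGMA c:UNIV. C i \<delta> c)
          {j \<in> zero_or_one_common I. out (L (alice_input j) (bob_input j)) \<longleftrightarrow> alice_input j \<inter> bob_input j = {}}"
        by (rule bij_betw_byWitness[where f' = "\<lambda>(i, \<delta>, Z, c). ((i, \<delta>), c, Z)"])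
          (auto simp: zero_or_one_common_def alice_input_def bob_input_def C_def Q_def put_def split: if_splits)
      from bij_betw_same_card[OF this, symmetric] show ?thesis
        using I fQ by (simp add: card_SigmaI C_def split_beta UNIV_bool add.commute)
    qed
    then have "2 / 3 * real (card (zero_or_one_common I)) \<le>
        (\<Sum>q\<in>Q. real (card (C (fst q) (snd q) False)) + real (card (C (fst q) (snd q) True)))"
      using correct by (simp add: split_beta)
    also have "\<dots> \<le> (\<Sum>q\<in>Q. t + W q)"
      using C by (intro sum_mono) (auto simp: Q_def)
    also have "\<dots> = card Q * t + (\<Sum>q\<in>Q. W q)" by (simp add: sum.distrib)
    also have "card Q * t = m * 4 ^ m / 4" by (simp add: card_Q tt[symmetric])
    finally show ?thesis
      using card_zero_or_one_common[OF I] by (simp add: m_def field_simps flip: of_nat_eq_iff[where 'a = real])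
  qed
  \<comment> \<open>The constant is \<open>144 * 8 = 1152\<close>, from the square of the
    \<open>12\<close> here and the \<open>8\<close> in \<open>upper\<close>.\<close>
  have "(m * 4 ^ m / 12)\<^sup>2 \<le> (\<Sum>q\<in>Q. W q)\<^sup>2"
    using lower by (intro power_mono) auto
  also note upper
  finally have "4 ^ m * (real m * 4 ^ m) * m \<le> 4 ^ m * (real m * 4 ^ m) * (1152 * ln (card \<Lambda>))"
    by (simp add: power2_eq_square field_simps)
  then show ?thesis using m by (simp add: m_def)
qed

section \<open>Lower bounds for randomized protocols\<close>

primrec leaf :: "('a, 'b, 'c) protocol \<Rightarrow> 'a \<Rightarrow> 'b \<Rightarrow> bool list" where
  "leaf (Output g) x y = []"
| "leaf (Alice_Bit h p q) x y = h x # (if h x then leaf p x y else leaf q x y)"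
| "leaf (Bob_Bit h p q) x y = h y # (if h y then leaf p x y else leaf q x y)"

primrec leaves :: "('a, 'b, 'c) protocol \<Rightarrow> bool list set" where
  "leaves (Output g) = {[]}"
| "leaves (Alice_Bit h p q) = Cons True ` leaves p \<union> Cons False ` leaves q"
| "leaves (Bob_Bit h p q) = Cons True ` leaves p \<union> Cons False ` leaves q"

lemma leaf_in_leaves: "leaf p x y \<in> leaves p"
  by (induction p) auto

lemma finite_leaves: "finite (leaves p)"
  by (induction p) auto

lemma card_leaves_le: "card (leaves p) \<le> 2 ^ cost p"
proof (induction p)
  case (Alice_Bit h p q)
  have "card (leaves (Alice_Bit h p q)) \<le> card (leaves p) + card (leaves q)"
    by (simp, rule order_trans[OF card_Un_le]) (simp add: card_image)
  also have "\<dots> \<le> 2 ^ max (cost p) (cost q) + 2 ^ max (cost p) (cost q)"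
    by (intro add_mono order_trans[OF Alice_Bit(1)] order_trans[OF Alice_Bit(2)] power_increasing) auto
  finally show ?case by simp
next
  case (Bob_Bit h p q)
  have "card (leaves (Bob_Bit h p q)) \<le> card (leaves p) + card (leaves q)"
    by (simp, rule order_trans[OF card_Un_le]) (simp add: card_image)
  also have "\<dots> \<le> 2 ^ max (cost p) (cost q) + 2 ^ max (cost p) (cost q)"
    by (intro add_mono order_trans[OF Bob_Bit(1)] order_trans[OF Bob_Bit(2)] power_increasing) auto
  finally show ?case by simp
qed simp

text \<open>Bob's input has to be the same in both runs, since he computes the output from it as
  well as from the leaf.\<close>

lemma run_eq_if_leaf_eq: "leaf p x y = leaf p x' y \<Longrightarrow> run p x y = run p x' y"
  by (induction p) (auto split: if_splits)

text \<open>Each bit on the path to a leaf depends on one player's input alone, so mixing two pairs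
  that reach the same leaf stays on that path.\<close>

lemma leaf_rectangle: "leaf p x y = leaf p x' y' \<Longrightarrow> leaf p x y' = leaf p x y"
  by (induction p) (auto split: if_splits)

text \<open>The output is made part of the label, so that the label determines the answer. Fibres
  stay rectangles because on a common leaf the output depends on Bob's input only.\<close>

lemma rectangular_run_leaf:
  "rectangular (\<lambda>x y. (run p (u x) (v y), leaf p (u x) (v y)))"
  unfolding rectangular_def
proof (intro allI impI)
  fix x y x' y'
  assume eq: "(run p (u x) (v y), leaf p (u x) (v y)) = (run p (u x') (v y'), leaf p (u x') (v y'))"
  then have leaf: "leaf p (u x) (v y') = leaf p (u x) (v y)"
    using leaf_rectangle[of p "u x" "v y" "u x'" "v y'"] by simp
  then have "run p (u x) (v y') = run p (u x') (v y')"
    using eq by (intro run_eq_if_leaf_eq) simp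
  then show "(run p (u x) (v y'), leaf p (u x) (v y')) = (run p (u x) (v y), leaf p (u x) (v y))"
    using eq leaf by simp
qed

section \<open>Fixing the public coins\<close>

text \<open>The expected number of events that occur is at least \<open>c * card J\<close>, so some
  point attains this number.\<close>

lemma (in prob_space) exists_point_in_many_events:
  fixes c :: real
  assumes J: "finite J" and E: "\<And>j. j \<in> J \<Longrightarrow> E j \<in> events" "\<And>j. j \<in> J \<Longrightarrow> c \<le> prob (E j)"
  shows "\<exists>\<omega>\<in>space M. c * real (card J) \<le> real (card {j\<in>J. \<omega> \<in> E j})"
proof (rule ccontr)
  assume "\<not> ?thesis"
  then have less: "real (card {j\<in>J. \<omega> \<in> E j}) < c * real (card J)" if "\<omega> \<in> space M" for \<omega>
    using that by force
  define X :: "'a \<Rightarrow> real" where "X \<omega> = (\<Sum>j\<in>J. indicator (E j) \<omega>)" for \<omega>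
  have X: "X \<omega> = real (card {j\<in>J. \<omega> \<in> E j})" for \<omega>
    using J by (simp add: X_def indicator_def sum.If_cases Int_def)
  have int: "integrable M (indicator (E j) :: 'a \<Rightarrow> real)" if "j \<in> J" for j
    using E(1)[OF that] by (simp add: emeasure_eq_measure)
  have "c * real (card J) = (\<Sum>j\<in>J. c)" by simp
  also have "\<dots> \<le> (\<Sum>j\<in>J. prob (E j))" by (intro sum_mono E)
  also have "\<dots> = expectation X"
    unfolding X_def using E(1) int by (subst Bochner_Integration.integral_sum) (auto simp: measure_def)
  also have "\<dots> < c * real (card J)"
  proof (rule expectation_less)
    show "integrable M X" unfolding X_def by (intro Bochner_Integration.integrable_sum int)
    show "AE \<omega> in M. X \<omega> < c * real (card J)" using less by (intro AE_I2) (simp add: X)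
  qed
  finally show False by simp
qed

text \<open>The easy half of Yao's principle, for the uniform distribution on \<open>J\<close>; the
  maps \<open>u\<close> and \<open>v\<close> allow input pairs to be repeated.\<close>

lemma computes_on_average:
  assumes "computes P A B f" and J: "finite J" "\<And>j. j \<in> J \<Longrightarrow> u j \<in> A" "\<And>j. j \<in> J \<Longrightarrow> v j \<in> B"
  shows "\<exists>r. 2 / 3 * real (card J) \<le> real (card {j\<in>J. run (P r) (u j) (v j) = f (u j) (v j)})"
proof -
  have "\<exists>r\<in>space coins. 2 / 3 * real (card J) \<le>
      real (card {j\<in>J. r \<in> {r \<in> space coins. run (P r) (u j) (v j) = f (u j) (v j)}})"
    using assms by (intro prob_space.exists_point_in_many_events[OF prob_space_coins])
      (auto simp: computes_def)
  then show ?thesis by auto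
qed

text \<open>A protocol for \<open>f\<close> solves disjointness on \<open>I\<close> through
  \<open>u\<close> and \<open>v\<close>. The labels are its leaves paired with the output bit, which
  accounts for the \<open>+ 1\<close>.\<close>

theorem R_comm_ge_of_disjointness:
  fixes f :: "'a \<Rightarrow> 'b \<Rightarrow> bool" and I :: "'i set"
  assumes "finite A" and I: "finite I"
    and u: "\<And>x. x \<subseteq> I \<Longrightarrow> u x \<in> A" and v: "\<And>y. y \<subseteq> I \<Longrightarrow> v y \<in> B"
    and f: "\<And>x y. x \<subseteq> I \<Longrightarrow> y \<subseteq> I \<Longrightarrow> f (u x) (v y) \<longleftrightarrow> x \<inter> y = {}"
  shows "real (card I) \<le> 1152 * (real (R_comm A B f) + 1)"
proof -
  obtain P where P: "computes P A B f" "\<And>r. cost (P r) \<le> R_comm A B f"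
    using R_comm_attained[OF assms(1)] by blast
  let ?J = "zero_or_one_common I"
  obtain r where r: "2 / 3 * real (card ?J) \<le> real (card {j\<in>?J.
      run (P r) (u (alice_input j)) (v (bob_input j)) = f (u (alice_input j)) (v (bob_input j))})"
    using computes_on_average[OF P(1) finite_zero_or_one_common[OF I],
        of "\<lambda>j. u (alice_input j)" "\<lambda>j. v (bob_input j)"]
      inputs_in_Pow u v by (meson PowD)
  define \<Lambda> where "\<Lambda> = (UNIV :: bool set) \<times> leaves (P r)"
  define L where "L x y = (run (P r) (u x) (v y), leaf (P r) (u x) (v y))" for x y
  have eq: "{j\<in>?J. run (P r) (u (alice_input j)) (v (bob_input j)) = f (u (alice_input j)) (v (bob_input j))}
    = {j\<in>?J. fst (L (alice_input j) (bob_input j)) \<longleftrightarrow> alice_input j \<inter> bob_input j = {}}"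
    using f inputs_in_Pow[of _ I] by (auto simp: L_def)
  have "real (card I) \<le> 1152 * ln (card \<Lambda>)"
  proof (rule disjointness_labels_lower_bound[OF I])
    show "rectangular L" unfolding L_def by (rule rectangular_run_leaf)
    show "finite \<Lambda>" by (simp add: \<Lambda>_def finite_leaves)
    show "L x y \<in> \<Lambda>" for x y by (simp add: L_def \<Lambda>_def leaf_in_leaves)
    show "2 / 3 * real (card ?J) \<le>
        real (card {j\<in>?J. fst (L (alice_input j) (bob_input j)) \<longleftrightarrow> alice_input j \<inter> bob_input j = {}})"
      using r eq by simp
  qed
  also have "ln (card \<Lambda>) \<le> real (R_comm A B f) + 1"
  proof -
    have "card \<Lambda> = 2 * card (leaves (P r))" by (simp add: \<Lambda>_def card_cartesian_product)
    also have "\<dots> \<le> 2 ^ (R_comm A B f + 1)"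
      using order_trans[OF card_leaves_le power_increasing[OF P(2)]] by simp
    finally have le: "real (card \<Lambda>) \<le> 2 ^ (R_comm A B f + 1)"
      by (metis of_nat_le_iff of_nat_numeral of_nat_power)
    have "leaves (P r) \<noteq> {}" using leaf_in_leaves by fastforce
    then have "0 < real (card \<Lambda>)" by (simp add: \<Lambda>_def card_gt_0_iff finite_leaves)
    with le have "ln (card \<Lambda>) \<le> ln (2 ^ (R_comm A B f + 1))" by (intro ln_mono) auto
    also have "\<dots> = real (R_comm A B f + 1) * ln 2" by (rule ln_realpow)
    also have "\<dots> \<le> real (R_comm A B f + 1) * 1"
      using ln_le_minus_one[of 2] by (intro mult_left_mono) auto
    finally show ?thesis by simp
  qed
  finally show ?thesis by simp
qed

text \<open>For a fixed \<open>y\<close> the leaf determines the output, and a correct output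
  determines Alice's input, so inputs answered correctly reach distinct leaves.\<close>

lemma R_comm_ge_of_injective:
  assumes A: "finite A" and y: "y \<in> B" and inj: "inj_on (\<lambda>x. f x y) A"
  shows "2 / 3 * real (card A) \<le> 2 ^ R_comm A B f"
proof -
  obtain P where P: "computes P A B f" "\<And>r. cost (P r) \<le> R_comm A B f"
    using R_comm_attained[OF A] by blast
  obtain r where r: "2 / 3 * real (card A) \<le> real (card {x\<in>A. run (P r) x y = f x y})"
    using computes_on_average[OF P(1) A, of "\<lambda>x. x" "\<lambda>_. y"] y by auto
  have "inj_on (\<lambda>x. leaf (P r) x y) {x\<in>A. run (P r) x y = f x y}"
  proof (rule inj_onI)
    fix x x' assume *: "x \<in> {x\<in>A. run (P r) x y = f x y}" "x' \<in> {x\<in>A. run (P r) x y = f x y}"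
      "leaf (P r) x y = leaf (P r) x' y"
    from run_eq_if_leaf_eq[OF *(3)] * show "x = x'" using inj by (auto dest: inj_onD)
  qed
  then have "card {x\<in>A. run (P r) x y = f x y} \<le> card (leaves (P r))"
    by (rule card_inj_on_le) (auto simp: leaf_in_leaves finite_leaves)
  also have "\<dots> \<le> 2 ^ R_comm A B f"
    using order_trans[OF card_leaves_le power_increasing[OF P(2)]] by simp
  finally have "real (card {x\<in>A. run (P r) x y = f x y}) \<le> 2 ^ R_comm A B f"
    by (metis of_nat_le_iff of_nat_numeral of_nat_power)
  with r show ?thesis by linarith
qed

lemma R_comm_le_R_one_way:
  assumes "finite A"
  shows "R_comm A B f \<le> R_one_way A B f"
  unfolding R_comm_def by (rule Least_le) (use R_one_way_attained[OF assms] in blast)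

section \<open>Families of bounded VC dimension\<close>

lemma shatteredD:
  assumes "shattered y S" "z \<subseteq> y"
  shows "\<exists>s\<in>S. y \<inter> s = z"
proof -
  have "z \<in> (\<lambda>x. y \<inter> x) ` S" using assms by (simp add: shattered_def)
  then show ?thesis by auto
qed

lemma shattered_subset:
  assumes "shattered y S" "z \<subseteq> y"
  shows "shattered z S"
  unfolding shattered_def
proof (intro equalityI subsetI)
  fix w assume "w \<in> Pow z"
  then obtain s where "s \<in> S" "y \<inter> s = w" using shatteredD[OF assms(1), of w] assms(2) by blast
  moreover have "z \<inter> s = w" using calculation \<open>w \<in> Pow z\<close> assms(2) by auto
  ultimately show "w \<in> (\<lambda>x. z \<inter> x) ` S" by auto
qed auto

lemma shattered_subset_Union:
  assumes "shattered y S" "S \<subseteq> Pow U"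
  shows "y \<subseteq> U"
  using shatteredD[OF assms(1) subset_refl] assms(2) by blast

text \<open>Pigeonhole: subsets of shattered sets are shattered, so no block contains more than
  \<open>t\<close> points of \<open>y\<close>.\<close>

lemma card_shattered_le_blocks:
  assumes y: "finite y" "shattered y S" "block ` y \<subseteq> {..<D}"
    and z: "\<And>z b. z \<subseteq> y \<Longrightarrow> card z = Suc t \<Longrightarrow> block ` z \<subseteq> {b} \<Longrightarrow> \<not> shattered z S"
  shows "card y \<le> D * t"
proof -
  have "card {u\<in>y. block u = b} \<le> t" for b
  proof (rule ccontr)
    assume "\<not> ?thesis"
    then obtain z where "z \<subseteq> {u\<in>y. block u = b}" "card z = Suc t"
      by (meson not_less_eq_eq obtain_subset_with_card_n)
    moreover from this have "shattered z S" by (intro shattered_subset[OF y(2)]) auto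
    ultimately show False using z[of z b] by auto
  qed
  then have "(\<Sum>b<D. card {u\<in>y. block u = b}) \<le> (\<Sum>b<D. t)" by (intro sum_mono)
  moreover have "y = (\<Union>b<D. {u\<in>y. block u = b})" using y by auto
  then have "card y \<le> (\<Sum>b<D. card {u\<in>y. block u = b})"
    by (metis card_UN_le finite_lessThan)
  ultimately show ?thesis by simp
qed

text \<open>The families are built on matrix cells or grids. Shattered sets pull back along an
  injection, which carries the bound over to the ground set \<open>X\<close>.\<close>

lemma VC_dim_image_le:
  assumes g: "inj_on g U" "g ` U \<subseteq> X" and S: "S \<subseteq> Pow U"
    and le: "\<And>y. y \<subseteq> U \<Longrightarrow> shattered y S \<Longrightarrow> card y \<le> d"
  shows "VC_dim X ((`) g ` S) \<le> d"
proof -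
  have "card y \<le> d" if y: "shattered y ((`) g ` S)" for y
  proof -
    define z where "z = {u\<in>U. g u \<in> y}"
    have "y \<subseteq> g ` U" using shattered_subset_Union[OF y, of "g ` U"] S by auto
    then have gz: "g ` z = y" by (auto simp: z_def)
    have "shattered z S"
      unfolding shattered_def
    proof (intro equalityI subsetI)
      fix w assume w: "w \<in> Pow z"
      then obtain s where s: "s \<in> S" "y \<inter> g ` s = g ` w"
        using shatteredD[OF y, of "g ` w"] gz by blast
      have "z \<subseteq> U" "s \<subseteq> U" "w \<subseteq> U" using s S w by (auto simp: z_def)
      then have "g ` (z \<inter> s) = g ` w"
        using s(2) gz inj_on_image_Int[OF g(1)] by metis
      then have "z \<inter> s = w"
        using inj_on_image_eq_iff[OF g(1), of "z \<inter> s" w] \<open>z \<subseteq> U\<close> \<open>w \<subseteq> U\<close> by auto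
      then show "w \<in> (\<lambda>x. z \<inter> x) ` S" using s by auto
    qed auto
    then have "card z \<le> d" by (intro le) (auto simp: z_def)
    moreover have "card y = card z"
      using card_image[of g z] inj_on_subset[OF g(1), of z] gz by (auto simp: z_def)
    ultimately show ?thesis by simp
  qed
  then have le: "k \<le> d" if "k \<in> card ` {y. y \<subseteq> X \<and> shattered y ((`) g ` S)}" for k
    using that by auto
  show ?thesis
    unfolding VC_dim_def
  proof (cases "card ` {y. y \<subseteq> X \<and> shattered y ((`) g ` S)} = {}")
    \<comment> \<open>Here no subset of \<open>X\<close> is shattered, not even the empty one, and
      \<open>Sup {}\<close> is 0.\<close>
    case True
    then show "Sup (card ` {y. y \<subseteq> X \<and> shattered y ((`) g ` S)}) \<le> d"
      by (simp only: Sup_nat_def) simp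
  next
    case False
    then show "Sup (card ` {y. y \<subseteq> X \<and> shattered y ((`) g ` S)}) \<le> d"
      by (rule cSup_least) (rule le)
  qed
qed

text \<open>The embedding: \<open>D\<close> blocks, each holding the ones of the \<open>2 ^ l \<times> 2 ^ l\<close> intersection matrix.
  In every block Alice's input selects a row and Bob's a column, and these have exactly one entry of
  the matrix in common, which belongs to the block if and only if the parts of the inputs intersect.\<close>

definition matrix_cells :: "nat \<Rightarrow> nat \<Rightarrow> (nat \<times> nat set \<times> nat set) set" where
  "matrix_cells D l = {(b, p, q). b < D \<and> p \<subseteq> {..<l} \<and> q \<subseteq> {..<l} \<and> p \<inter> q \<noteq> {}}"

definition matrix_rows :: "nat \<Rightarrow> nat \<Rightarrow> (nat \<times> nat) set \<Rightarrow> (nat \<times> nat set \<times> nat set) set" where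
  "matrix_rows D l x = {(b, p, q) \<in> matrix_cells D l. p = x `` {b}}"

definition matrix_columns :: "nat \<Rightarrow> nat \<Rightarrow> (nat \<times> nat) set \<Rightarrow> (nat \<times> nat set \<times> nat set) set" where
  "matrix_columns D l y = {(b, p, q) \<in> matrix_cells D l. q = y `` {b}}"

lemma finite_card_matrix_cells: "finite (matrix_cells D l) \<and> card (matrix_cells D l) \<le> D * 4 ^ l"
proof -
  have sub: "matrix_cells D l \<subseteq> {..<D} \<times> Pow {..<l} \<times> Pow {..<l}"
    by (auto simp: matrix_cells_def)
  have "card (matrix_cells D l) \<le> card ({..<D} \<times> Pow {..<l} \<times> Pow {..<l})"
    by (rule card_mono[OF _ sub]) auto
  also have "\<dots> = D * 4 ^ l"
    by (simp add: card_cartesian_product card_Pow power_mult_distrib[symmetric])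
  finally show ?thesis using finite_subset[OF sub] by auto
qed

lemma matrix_rows_columns_disjoint:
  assumes "x \<subseteq> {..<D} \<times> {..<l}" "y \<subseteq> {..<D} \<times> {..<l}"
  shows "matrix_rows D l x \<inter> matrix_columns D l y = {} \<longleftrightarrow> x \<inter> y = {}"
proof -
  have "matrix_rows D l x \<inter> matrix_columns D l y
      = {(b, p, q). b < D \<and> p = x `` {b} \<and> q = y `` {b} \<and> p \<inter> q \<noteq> {}}"
    using assms by (auto simp: matrix_rows_def matrix_columns_def matrix_cells_def)
  also have "\<dots> = {} \<longleftrightarrow> (\<forall>b<D. x `` {b} \<inter> y `` {b} = {})" by auto
  also have "\<dots> \<longleftrightarrow> x \<inter> y = {}" using assms by (auto 4 4)
  finally show ?thesis .
qed

text \<open>Of the four traces with at least two elements on three cells of a block, the full one makes the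
  cells share a row, say; then two of the others must come from columns, which is impossible.\<close>

lemma not_shattered_three_cells:
  assumes "card z = Suc 2" "fst ` z \<subseteq> {b}"
    and sh: "shattered z (range (matrix_rows D l) \<union> range (matrix_columns D l))"
  shows False
proof -
  have "card z = 3" using assms(1) by simp
  then obtain u v w where z: "z = {u, v, w}" and ne: "u \<noteq> v" "u \<noteq> w" "v \<noteq> w"
    unfolding card_3_iff by blast
  have cells: "z \<subseteq> matrix_cells D l"
    by (rule shattered_subset_Union[OF sh]) (auto simp: matrix_rows_def matrix_columns_def)
  define p where "p = (\<lambda>c :: nat \<times> nat set \<times> nat set. fst (snd c))"
  define q where "q = (\<lambda>c :: nat \<times> nat set \<times> nat set. snd (snd c))"
  have row: "c \<in> matrix_rows D l x \<longleftrightarrow> p c = x `` {b}"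
    and column: "c \<in> matrix_columns D l x \<longleftrightarrow> q c = x `` {b}" if "c \<in> z" for c x
    using that cells assms(2) by (auto simp: matrix_rows_def matrix_columns_def p_def q_def)
  have trace: "(\<exists>P. \<forall>c\<in>z. c \<in> t \<longleftrightarrow> p c = P) \<or> (\<exists>Q. \<forall>c\<in>z. c \<in> t \<longleftrightarrow> q c = Q)"
    if t: "t \<subseteq> z" for t
  proof -
    obtain s where s: "s \<in> range (matrix_rows D l) \<union> range (matrix_columns D l)" "z \<inter> s = t"
      using shatteredD[OF sh t] by blast
    then have mem: "c \<in> t \<longleftrightarrow> c \<in> s" if "c \<in> z" for c using that by blast
    consider x where "s = matrix_rows D l x" | x where "s = matrix_columns D l x"
      using s(1) by blast
    then show ?thesis
    proof cases
      case 1
      then have "\<forall>c\<in>z. c \<in> t \<longleftrightarrow> p c = x `` {b}" using mem row by simp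
      then show ?thesis by blast
    next
      case 2
      then have "\<forall>c\<in>z. c \<in> t \<longleftrightarrow> q c = x `` {b}" using mem column by simp
      then show ?thesis by blast
    qed
  qed
  have ne': "v \<noteq> u" "w \<noteq> u" "w \<noteq> v" using ne by auto
  have uvw: "p u = p v \<and> p u = p w \<or> q u = q v \<and> q u = q w"
    using trace[of "{u, v, w}"] by (auto simp: z)
  have uv: "p u = p v \<and> p u \<noteq> p w \<or> q u = q v \<and> q u \<noteq> q w"
    using trace[of "{u, v}"] ne ne' by (auto simp: z)
  have uw: "p u = p w \<and> p u \<noteq> p v \<or> q u = q w \<and> q u \<noteq> q v"
    using trace[of "{u, w}"] ne ne' by (auto simp: z)
  show False using uvw uv uw by auto
qed

lemma card_shattered_matrix_le:
  assumes "shattered y (range (matrix_rows D l) \<union> range (matrix_columns D l))"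
  shows "card y \<le> D * 2"
proof -
  have y: "y \<subseteq> matrix_cells D l"
    by (rule shattered_subset_Union[OF assms]) (auto simp: matrix_rows_def matrix_columns_def)
  then have "finite y" using finite_card_matrix_cells finite_subset by blast
  moreover have "fst ` y \<subseteq> {..<D}" using y by (auto simp: matrix_cells_def)
  ultimately show ?thesis
    using assms not_shattered_three_cells by (intro card_shattered_le_blocks) blast+
qed

section \<open>Two-way lower bound for disjointness\<close>

text \<open>Both players draw from one family, which therefore contains rows and columns.
  Restricting Alice to rows and Bob to columns recovers disjointness on \<open>D * l\<close>
  points.\<close>

lemma disjointness_family:
  assumes cells: "D * 4 ^ l \<le> n"
  shows "\<exists>S. S \<subseteq> Pow {1..n} \<and> VC_dim {1..n} S \<le> 2 * D \<and>
    real (D * l) \<le> 1152 * (real (R_comm S S Disj) + 1)"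
proof -
  let ?U = "matrix_cells D l" and ?S = "range (matrix_rows D l) \<union> range (matrix_columns D l)"
  have "card ?U \<le> card {1..n}" using finite_card_matrix_cells[of D l] cells by simp
  from card_le_inj[OF conjunct1[OF finite_card_matrix_cells] finite_atLeastAtMost this]
  obtain g where g: "inj_on g ?U" "g ` ?U \<subseteq> {1..n}" by blast
  let ?T = "(`) g ` ?S"
  have S: "?S \<subseteq> Pow ?U" by (auto simp: matrix_rows_def matrix_columns_def)
  have T: "?T \<subseteq> Pow {1..n}"
  proof (rule image_subsetI)
    fix s assume "s \<in> ?S"
    then have "s \<subseteq> ?U" using S by blast
    then show "g ` s \<in> Pow {1..n}" using g(2) by blast
  qed
  have "VC_dim {1..n} ?T \<le> 2 * D"
    by (rule VC_dim_image_le[OF g S]) (simp only: mult.commute[of 2 D] card_shattered_matrix_le)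
  moreover have "real (card ({..<D} \<times> {..<l})) \<le> 1152 * (real (R_comm ?T ?T Disj) + 1)"
  proof (rule R_comm_ge_of_disjointness)
    show "finite ?T" by (rule finite_subset[OF T]) simp
    show "Disj (g ` matrix_rows D l x) (g ` matrix_columns D l y) \<longleftrightarrow> x \<inter> y = {}"
      if "x \<subseteq> {..<D} \<times> {..<l}" "y \<subseteq> {..<D} \<times> {..<l}" for x y
    proof -
      have "g ` matrix_rows D l x \<inter> g ` matrix_columns D l y = g ` (matrix_rows D l x \<inter> matrix_columns D l y)"
        using S by (intro inj_on_image_Int[OF g(1), symmetric]) blast+
      then show ?thesis using matrix_rows_columns_disjoint[OF that] by (simp add: Disj_def)
    qed
  qed auto
  ultimately show ?thesis using T by (auto simp: card_cartesian_product)
qed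

lemma disjointness_lower_bound:
  "\<exists>K. \<forall>n d::nat. 2 \<le> d \<and> d \<le> n \<and> K \<le> real n / real d \<longrightarrow>
     (\<exists>S. S \<subseteq> Pow {1..n} \<and> VC_dim {1..n} S \<le> d \<and>
       1 / 27648 * (real d * log 2 (real n / real d)) \<le> real (R_comm S S Disj))"
proof -
  \<comment> \<open>Large enough that \<open>D * l\<close> exceeds 1152 below, which forces a
    nonzero complexity and so lets the \<open>+ 1\<close> be absorbed.\<close>
  define N :: nat where "N = 1153"
  have "\<exists>S. S \<subseteq> Pow {1..n} \<and> VC_dim {1..n} S \<le> d \<and>
       1 / 27648 * (real d * log 2 (real n / real d)) \<le> real (R_comm S S Disj)"
    if d: "2 \<le> d" and nd: "4 ^ N \<le> real n / real d" for n d :: nat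
  proof -
    define k where "k = n div d"
    define D where "D = d div 2"
    have "4 ^ N * real d \<le> real n" using d nd by (simp add: field_simps)
    then have "4 ^ N * d \<le> n" by (metis of_nat_le_iff of_nat_mult of_nat_numeral of_nat_power)
    then have k: "4 ^ N \<le> k" using d by (simp add: k_def less_eq_div_iff_mult_less_eq)
    then have "1 \<le> k" by (meson one_le_numeral one_le_power order_trans)
    \<comment> \<open>\<open>l\<close> is about half the logarithm of \<open>n / d\<close>, and the
      \<open>D\<close> matrices fit because \<open>D * 4 ^ l \<le> d * k \<le> n\<close>.\<close>
    then obtain l where l: "4 ^ l \<le> k" "k < 4 ^ (l + 1)"
      using ex_power_ivl1[of 4 k] by auto
    have "N \<le> l"
    proof -
      have "(4::nat) ^ N < 4 ^ (l + 1)" using k l(2) by linarith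
      then show ?thesis by (simp add: power_strict_increasing_iff del: power_Suc)
    qed
    have "D * 4 ^ l \<le> d * k" using l(1) by (intro mult_mono) (auto simp: D_def)
    also have "\<dots> \<le> n" by (simp add: k_def)
    finally obtain S where S: "S \<subseteq> Pow {1..n}" "VC_dim {1..n} S \<le> 2 * D"
      "real (D * l) \<le> 1152 * (real (R_comm S S Disj) + 1)"
      using disjointness_family by blast
    \<comment> \<open>The first bound needs \<open>d \<ge> 2\<close>; the second is tight at
      \<open>d = 3\<close>.\<close>
    have D: "1 \<le> D" "d \<le> 3 * D" "2 * D \<le> d" using d by (auto simp: D_def)
    have "n < d * (k + 1)" using d by (simp add: k_def dividend_less_times_div)
    also have "\<dots> \<le> d * 4 ^ (l + 1)" using l(2) by (intro mult_left_mono) auto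
    finally have "real n < real d * 4 ^ (l + 1)"
      by (metis of_nat_less_iff of_nat_mult of_nat_numeral of_nat_power)
    then have ratio: "real n / real d \<le> 4 ^ (l + 1)" using d by (simp add: field_simps)
    have pos: "0 < real n / real d" by (rule less_le_trans[OF _ nd]) simp
    have "log 2 (real n / real d) \<le> log 2 (4 ^ (l + 1))" using ratio pos by simp
    also have "\<dots> = 2 * (real l + 1)"
    proof -
      have "log 2 (4::real) = 2" using log_nat_power[of 2 2 2] by simp
      then show ?thesis using log_nat_power[of 4 2 "l + 1"] by simp
    qed
    also have "\<dots> \<le> 4 * real l" using \<open>N \<le> l\<close> by (simp add: N_def)
    finally have log: "log 2 (real n / real d) \<le> 4 * real l" .
    \<comment> \<open>The constant is \<open>27648 = 3 * 4 * 1152 * 2\<close>: the factors come from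
      \<open>d \<le> 3 * D\<close>, the logarithm, the disjointness bound and the absorbed
      \<open>+ 1\<close>.\<close>
    have "real d * log 2 (real n / real d) \<le> (3 * real D) * (4 * real l)"
    proof (intro mult_mono)
      have "1 \<le> real n / real d" by (rule order_trans[OF one_le_power nd]) simp
      then show "0 \<le> log 2 (real n / real d)" by simp
    qed (use D log in auto)
    also have "(3 * real D) * (4 * real l) = 12 * real (D * l)" by simp
    also have "\<dots> \<le> 12 * (1152 * (real (R_comm S S Disj) + 1))"
      using S(3) by (rule mult_left_mono) simp
    also have "\<dots> \<le> 12 * (1152 * (real (R_comm S S Disj) + real (R_comm S S Disj)))"
    proof -
      have "1153 \<le> l" using \<open>N \<le> l\<close> by (simp add: N_def)
      then have "1 * 1153 \<le> D * l" using D by (intro mult_mono) auto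
      then have "(1153::real) \<le> real (D * l)"
        by (metis mult_1 of_nat_le_iff of_nat_numeral)
      then have "1153 \<le> 1152 * (real (R_comm S S Disj) + 1)" using S(3) by (rule order_trans)
      then have "R_comm S S Disj \<noteq> 0" by auto
      then show ?thesis by simp
    qed
    finally have "1 / 27648 * (real d * log 2 (real n / real d)) \<le> real (R_comm S S Disj)"
      by simp
    then show ?thesis using S D by (intro exI[of _ S]) auto
  qed
  then show ?thesis by (intro exI[of _ "4 ^ N"]) blast
qed

section \<open>Products of chains and the lower bound for intersection\<close>

text \<open>A product of \<open>d\<close> chains of initial segments. The height functions are
  extensional, so that distinct ones give distinct sets.\<close>

definition prefix_family :: "nat \<Rightarrow> nat \<Rightarrow> (nat \<times> nat) set set" where
  "prefix_family d m = (\<lambda>h. {(b, j). b < d \<and> j < h b}) ` ({..<d} \<rightarrow>\<^sub>E {..m})"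

lemma card_prefix_family: "card (prefix_family d m) = (m + 1) ^ d"
proof -
  have "inj_on (\<lambda>h. {(b, j). b < d \<and> j < h b}) ({..<d} \<rightarrow>\<^sub>E {..m})"
  proof (rule inj_onI)
    fix h h' :: "nat \<Rightarrow> nat"
    assume h: "h \<in> {..<d} \<rightarrow>\<^sub>E {..m}" "h' \<in> {..<d} \<rightarrow>\<^sub>E {..m}"
      and eq: "{(b, j). b < d \<and> j < h b} = {(b, j). b < d \<and> j < h' b}"
    have "h b = h' b" if "b < d" for b
    proof -
      have "j < h b \<longleftrightarrow> j < h' b" for j
        using eq that by (auto simp: set_eq_iff)
      then show ?thesis by (meson less_irrefl linorder_neqE_nat)
    qed
    then show "h = h'" using h by (intro PiE_ext) auto
  qed
  then show ?thesis by (simp add: prefix_family_def card_image card_PiE)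
qed

lemma prefix_family_subset: "prefix_family d m \<subseteq> Pow ({..<d} \<times> {..<m})"
  unfolding prefix_family_def
proof (rule image_subsetI)
  fix h assume "h \<in> {..<d} \<rightarrow>\<^sub>E {..m}"
  then have "h b \<le> m" if "b < d" for b using that PiE_mem[of h] by auto
  then show "{(b, j). b < d \<and> j < h b} \<in> Pow ({..<d} \<times> {..<m})" by (auto intro: less_le_trans)
qed

text \<open>In one block the members are initial segments, so of two points the upper one never
  occurs without the lower one.\<close>

lemma card_shattered_prefix_family_le:
  assumes "shattered y (prefix_family d m)"
  shows "card y \<le> d"
proof -
  have y: "y \<subseteq> {..<d} \<times> {..<m}"
    by (rule shattered_subset_Union[OF assms prefix_family_subset])
  have "card y \<le> d * 1"
  proof (rule card_shattered_le_blocks[OF _ assms])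
    show "finite y" by (rule finite_subset[OF y]) simp
    show "fst ` y \<subseteq> {..<d}" using y by auto
    fix z b assume z: "z \<subseteq> y" "card z = Suc 1" "fst ` z \<subseteq> {b}"
    obtain u v where uv: "z = {u, v}" "u \<noteq> v" using z(2) by (auto simp: card_Suc_eq)
    have less: False if sh: "shattered {(b, i), (b, j)} (prefix_family d m)" and "i < j" for i j
    proof -
      obtain s where s: "s \<in> prefix_family d m" "{(b, i), (b, j)} \<inter> s = {(b, j)}"
        using shatteredD[OF sh, of "{(b, j)}"] by blast
      have "(b, j) \<in> s" "(b, i) \<notin> s" using s(2) \<open>i < j\<close> by (auto simp: set_eq_iff)
      moreover obtain h where "s = {(b, j). b < d \<and> j < h b}"
        using s(1) unfolding prefix_family_def by blast
      ultimately show False using \<open>i < j\<close> by simp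
    qed
    define i j where "i = snd u" and "j = snd v"
    then have ij: "u = (b, i)" "v = (b, j)" using z(3) uv(1) by (auto simp: prod_eq_iff)
    then consider "i < j" | "j < i" using uv(2) by fastforce
    then show "\<not> shattered z (prefix_family d m)"
    proof cases
      case 1
      then show ?thesis using less[of i j] uv(1) ij by metis
    next
      case 2
      then show ?thesis using less[of j i] uv(1) ij by (metis insert_commute)
    qed
  qed
  then show ?thesis by simp
qed

lemma intersection_family:
  assumes "d * m \<le> n"
  shows "\<exists>S. S \<subseteq> Pow {1..n} \<and> VC_dim {1..n} S \<le> d \<and>
    2 / 3 * real ((m + 1) ^ d) \<le> 2 ^ R_comm S S Inter_fun"
proof -
  let ?U = "{..<d} \<times> {..<m}" and ?S = "prefix_family d m"
  have "card ?U \<le> card {1..n}" using assms by (simp add: card_cartesian_product)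
  then obtain g where g: "inj_on g ?U" "g ` ?U \<subseteq> {1..n}"
    using card_le_inj[of ?U "{1..n}"] by blast
  let ?T = "(`) g ` ?S"
  have S: "?S \<subseteq> Pow ?U" by (rule prefix_family_subset)
  have T: "?T \<subseteq> Pow {1..n}" using S g(2) by blast
  have fT: "finite ?T" by (rule finite_subset[OF T]) simp
  have VC: "VC_dim {1..n} ?T \<le> d"
    by (rule VC_dim_image_le[OF g S]) (rule card_shattered_prefix_family_le)
  \<comment> \<open>Heights all equal to \<open>m\<close> give the full grid. Its image is Bob's
    set, so that the intersection returns Alice's set.\<close>
  have "?U \<in> ?S"
    unfolding prefix_family_def by (rule image_eqI[of _ _ "restrict (\<lambda>_. m) {..<d}"]) auto
  then have full: "g ` ?U \<in> ?T" by (rule imageI)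
  have inj: "inj_on (\<lambda>x. Inter_fun x (g ` ?U)) ?T"
  proof (rule inj_onI)
    fix x x' assume x: "x \<in> ?T" "x' \<in> ?T" and eq: "Inter_fun x (g ` ?U) = Inter_fun x' (g ` ?U)"
    have "x \<subseteq> g ` ?U" "x' \<subseteq> g ` ?U" using x S by blast+
    then show "x = x'" using eq by (auto simp: Inter_fun_def Int_absorb2)
  qed
  have "2 / 3 * real (card ?T) \<le> 2 ^ R_comm ?T ?T Inter_fun"
    by (rule R_comm_ge_of_injective[where f = Inter_fun, OF fT full inj])
  moreover have "card ?T = (m + 1) ^ d"
    using inj_on_subset[OF inj_on_image_Pow[OF g(1)] S] by (simp add: card_image card_prefix_family)
  ultimately show ?thesis using T VC by (intro exI[of _ ?T]) simp
qed

lemma intersection_lower_bound: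
  assumes d: "1 \<le> d" and nd: "4 \<le> real n / real d"
  shows "\<exists>S. S \<subseteq> Pow {1..n} \<and> VC_dim {1..n} S \<le> d \<and>
    1 / 2 * (real d * log 2 (real n / real d)) \<le> real (R_comm S S Inter_fun)"
proof -
  define m where "m = n div d"
  have "d * m \<le> n" by (simp add: m_def)
  then obtain S where S: "S \<subseteq> Pow {1..n}" "VC_dim {1..n} S \<le> d"
    "2 / 3 * real ((m + 1) ^ d) \<le> 2 ^ R_comm S S Inter_fun"
    using intersection_family by blast
  have "n < d * (m + 1)" using d by (simp add: m_def dividend_less_times_div)
  then have "real n \<le> real d * real (m + 1)" by (metis less_imp_le of_nat_le_iff of_nat_mult)
  then have "real n / real d \<le> real (m + 1)" using d by (simp add: field_simps)
  then have "(real n / real d) ^ d \<le> real (m + 1) ^ d" using nd by (intro power_mono) auto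
  also have "\<dots> \<le> 3 / 2 * 2 ^ R_comm S S Inter_fun" using S(3) by simp
  \<comment> \<open>The factor \<open>3 / 2\<close> from the error probability costs at most one
    more bit.\<close>
  also have "\<dots> \<le> 2 ^ (R_comm S S Inter_fun + 1)" by simp
  finally have "log 2 ((real n / real d) ^ d) \<le> log 2 (2 ^ (R_comm S S Inter_fun + 1))"
    using nd by (intro log_mono) (auto simp del: power_Suc)
  then have 1: "real d * log 2 (real n / real d) \<le> real (R_comm S S Inter_fun) + 1"
    using nd log_nat_power[of 2 2 "R_comm S S Inter_fun + 1"] by (simp add: log_nat_power)
  \<comment> \<open>From \<open>n / d \<ge> 4\<close> the main term is at least 2, so losing one bit
    leaves at least half of it.\<close>
  have "log 2 4 \<le> log 2 (real n / real d)" using nd by simp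
  moreover have "log 2 (4::real) = 2" using log_nat_power[of 2 2 2] by simp
  ultimately have "1 * 2 \<le> real d * log 2 (real n / real d)" using d by (intro mult_mono) auto
  with 1 have "1 / 2 * (real d * log 2 (real n / real d)) \<le> real (R_comm S S Inter_fun)"
    by linarith
  then show ?thesis using S by blast
qed

text \<open>Both bounds for disjointness follow from the two-way estimate without the double
  logarithm. They start at \<open>d = 2\<close> because disjointness has bounded complexity on
  families of VC dimension at most 1.\<close>

theorem theorem6:
  shows
    "(\<exists>c::real. c > 0 \<and> (\<exists>K::real. \<forall>n d::nat. 2 \<le> d \<and> d \<le> n \<and> K \<le> real n / real d \<longrightarrow>
        (\<exists>S. S \<subseteq> Pow {1..n} \<and> VC_dim {1..n} S \<le> d \<and>
           c * (real d * log 2 (real n / real d)) \<le> real (R_one_way S S Disj)))) \<and>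
     (\<exists>c::real. c > 0 \<and> (\<exists>K::real. \<forall>n d::nat. 2 \<le> d \<and> d \<le> n \<and> K \<le> real n / real d \<longrightarrow>
        (\<exists>S. S \<subseteq> Pow {1..n} \<and> VC_dim {1..n} S \<le> d \<and>
           c * (real d * (log 2 (real n / real d) / log 2 (log 2 (real n / real d))))
             \<le> real (R_comm S S Disj)))) \<and>
     (\<exists>c::real. c > 0 \<and> (\<exists>K::real. \<forall>n d::nat. 1 \<le> d \<and> d \<le> n \<and> K \<le> real n / real d \<longrightarrow>
        (\<exists>S. S \<subseteq> Pow {1..n} \<and> VC_dim {1..n} S \<le> d \<and>
           c * (real d * log 2 (real n / real d)) \<le> real (R_comm S S Inter_fun))))"
proof -
  obtain K where K: "\<And>n d::nat. 2 \<le> d \<Longrightarrow> d \<le> n \<Longrightarrow> K \<le> real n / real d \<Longrightarrow>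
      \<exists>S. S \<subseteq> Pow {1..n} \<and> VC_dim {1..n} S \<le> d \<and>
        1 / 27648 * (real d * log 2 (real n / real d)) \<le> real (R_comm S S Disj)"
    using disjointness_lower_bound by blast
  have one_way: "\<exists>S. S \<subseteq> Pow {1..n} \<and> VC_dim {1..n} S \<le> d \<and>
        1 / 27648 * (real d * log 2 (real n / real d)) \<le> real (R_one_way S S Disj)"
    if nd: "2 \<le> d \<and> d \<le> n \<and> K \<le> real n / real d" for n d :: nat
  proof -
    from K[of d n] nd obtain S where S: "S \<subseteq> Pow {1..n}" "VC_dim {1..n} S \<le> d"
        "1 / 27648 * (real d * log 2 (real n / real d)) \<le> real (R_comm S S Disj)"
      by blast
    have "finite S" by (rule finite_subset[OF S(1)]) simp
    then have "real (R_comm S S Disj) \<le> real (R_one_way S S Disj)"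
      by (simp add: R_comm_le_R_one_way)
    with S show ?thesis by (meson order_trans)
  qed
  have two_way: "\<exists>S. S \<subseteq> Pow {1..n} \<and> VC_dim {1..n} S \<le> d \<and>
        1 / 27648 * (real d * (log 2 (real n / real d) / log 2 (log 2 (real n / real d))))
          \<le> real (R_comm S S Disj)"
    if nd: "2 \<le> d \<and> d \<le> n \<and> max K 4 \<le> real n / real d" for n d :: nat
  proof -
    from nd have "2 \<le> d" "d \<le> n" "K \<le> real n / real d" by auto
    from K[OF this] obtain S where S: "S \<subseteq> Pow {1..n}" "VC_dim {1..n} S \<le> d"
        "1 / 27648 * (real d * log 2 (real n / real d)) \<le> real (R_comm S S Disj)"
      by blast
    define r where "r = log 2 (real n / real d)"
    \<comment> \<open>For \<open>n / d \<ge> 4\<close> the double logarithm is at least 1, so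
      dividing by it only weakens the bound; hence the threshold \<open>max K 4\<close>.\<close>
    have "log 2 4 \<le> r" unfolding r_def using nd by (intro log_mono) auto
    moreover have "log 2 (4::real) = 2" using log_nat_power[of 2 2 2] by simp
    ultimately have r: "2 \<le> r" by simp
    then have "log 2 2 \<le> log 2 r" by (intro log_mono) auto
    then have "1 \<le> log 2 r" by simp
    then have "r / log 2 r \<le> r / 1" using r by (intro divide_left_mono) auto
    then have "1 / 27648 * (real d * (r / log 2 r)) \<le> 1 / 27648 * (real d * r)"
      by (intro mult_left_mono) auto
    with S show ?thesis unfolding r_def by (meson order_trans)
  qed
  show ?thesis
  proof (intro conjI)
    show "\<exists>c::real. c > 0 \<and> (\<exists>K::real. \<forall>n d::nat. 2 \<le> d \<and> d \<le> n \<and> K \<le> real n / real d \<longrightarrow>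
        (\<exists>S. S \<subseteq> Pow {1..n} \<and> VC_dim {1..n} S \<le> d \<and>
           c * (real d * log 2 (real n / real d)) \<le> real (R_one_way S S Disj)))"
      by (rule exI[of _ "1 / 27648"], rule conjI, simp, rule exI[of _ "K"], intro allI impI, rule one_way, assumption)
    show "\<exists>c::real. c > 0 \<and> (\<exists>K::real. \<forall>n d::nat. 2 \<le> d \<and> d \<le> n \<and> K \<le> real n / real d \<longrightarrow>
        (\<exists>S. S \<subseteq> Pow {1..n} \<and> VC_dim {1..n} S \<le> d \<and>
           c * (real d * (log 2 (real n / real d) / log 2 (log 2 (real n / real d))))
             \<le> real (R_comm S S Disj)))"
      by (rule exI[of _ "1 / 27648"], rule conjI, simp, rule exI[of _ "max K 4"], intro allI impI, rule two_way, assumption)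
    show "\<exists>c::real. c > 0 \<and> (\<exists>K::real. \<forall>n d::nat. 1 \<le> d \<and> d \<le> n \<and> K \<le> real n / real d \<longrightarrow>
        (\<exists>S. S \<subseteq> Pow {1..n} \<and> VC_dim {1..n} S \<le> d \<and>
           c * (real d * log 2 (real n / real d)) \<le> real (R_comm S S Inter_fun)))"
      by (rule exI[of _ "1 / 2"], rule conjI, simp, rule exI[of _ "4"], intro allI impI, rule intersection_lower_bound, simp_all)
  qed
qed

end
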